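(* Let $g:\mathbb{N}\to\mathbb{N}$ be a smooth control function that is eventually bounded by a function in $\mathscr{F}_\gamma$ (i.e., there are $f\in\mathscr{F}_\gamma$ and $x_0$ with $g(x)\leq f(x)$ for all $x\geq x_0$), and let $A$ be an exponential nwqo whose maximal order type satisfies $o(A)<\omega^{\beta+1}$. Then the length function $L_{A,g}$ is bounded by a function in (1) $\mathscr{F}_\beta$ if $\gamma<\omega$ and $\beta\geq\omega$; (2) $\mathscr{F}_{\gamma+\beta}$ if $\gamma\geq 2$ and $\beta<\omega$. (Bounded by a function in $\mathscr{F}$ means: there exists $f\in\mathscr{F}$ with $L_{A,g}(n)\leq f(n)$ for all $n$.)
   Context: A wqo is a quasi-ordering $(A,\leq_A)$ in which every infinite sequence $x_0,x_1,\ldots$ has $i<j$ with $x_i\leq_A x_j$. A normed wqo (nwqo) is a wqo with a norm $|\cdot|_A:A\to\mathbb{N}$ that is proper ($\{x:|x|_A<n\}$ is finite for all $n$). A sequence is bad if there are no $i<j$ with $x_i\leq x_j$; it is $(g,n)$-controlled if $|x_i|_A<g^i(n)$ for all $i$ ($g^i$ the $i$-fold iterate, $g^0(n)=n$). $L_{A,g}(n)$ is the maximal length of a $(g,n)$-controlled bad sequence over $A$ (it exists). A control function $g$ is smooth if $g(x+1)\geq g(x)+1\geq x+2$ for all $x$. Basic nwqos: $\Gamma_p=\{a_1,\ldots,a_p\}$ with distinct letters incomparable and $|a_i|=0$. Constructions: disjoint sum $A_1+A_2=\{\langle i,x\rangle: x\in A_i\}$ with $\langle i,x\rangle\leq\langle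 j,y\rangle$ iff $i=j$ and $x\leq_{A_i}y$, norm $|\langle i,x\rangle|=|x|_{A_i}$; product $A_1\times A_2$ with componentwise order and norm $\max(|x_1|,|x_2|)$; Kleene star $A^*$ = finite lists over $A$ with $(x_1\ldots x_n)\leq(y_1\ldots y_m)$ iff there are $1\leq i_1<\cdots<i_n\leq m$ with $x_j\leq_A y_{i_j}$, and norm $\max(n,|x_1|_A,\ldots,|x_n|_A)$. An exponential nwqo is one built from the $\Gamma_p$ by $+$, $\times$, and Kleene star applied only to some $\Gamma_p$. Ordinals below $\varepsilon_0$ are written in Cantor normal form; $\oplus,\otimes$ are the natural (Hessenberg) sum and product. The maximal order type $o(A)$ of an exponential nwqo is computed by $o(\Gamma_p)=p$, $o(\Gamma_0^* )=1$, $o(\Gamma_{p+1}^* )=\omega^{\omega^p}$, $o(A+B)=o(A)\oplus o(B)$, $o(A\times B)=o(A)\otimes o(B)$. Fast-growing functions (with $\omega_x=x$): fundamental sequences $(\gamma+\omega^{\beta+1})_x=\gamma+\omega^\beta\cdot x$, $(\gamma+\omega^{\lambda})_x=\gamma+\omega^{\lambda_x}$; $F_0(x)=x+1$, $F_{\alpha+1}(x)=F_\alpha^{x}(x)$, $F_\lambda(x)=F_{\lambda_x}(x)$. $\mathscr{F}_\alpha$ is the closure of constants, addition, projections and $F_\alpha$ under substitution and limited recursion. *)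

theory Defs
  imports Main "HOL-Library.Sublist"
begin

section \<open>Ordinals below epsilon-zero in Cantor normal form\<close>

text \<open>\<open>OmegaPlus a b\<close> denotes \<open>\<omega>\<^sup>a + b\<close>. The ordinals below epsilon-zero are the terms satisfying
  \<open>is_cnf\<close>, i.e. the sums of powers of \<open>\<omega>\<close> with hereditarily non-increasing exponents; on those terms
  the lexicographic order below is the order of ordinals.\<close>

datatype cnf = Zero | OmegaPlus cnf cnf

fun cnf_less :: "cnf \<Rightarrow> cnf \<Rightarrow> bool" where
  "cnf_less s Zero = False"
| "cnf_less Zero (OmegaPlus c d) = True"
| "cnf_less (OmegaPlus a b) (OmegaPlus c d) = (cnf_less a c \<or> a = c \<and> cnf_less b d)"

instantiation cnf :: linorder
begin

definition less_cnf :: "cnf \<Rightarrow> cnf \<Rightarrow> bool" where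
  "s < t \<longleftrightarrow> cnf_less s t"

definition less_eq_cnf :: "cnf \<Rightarrow> cnf \<Rightarrow> bool" where
  "s \<le> t \<longleftrightarrow> s < t \<or> s = (t :: cnf)"

instance
proof
  have irrefl: "\<not> cnf_less s s" for s
    by (induction s) auto
  have trans: "cnf_less s t \<Longrightarrow> cnf_less t u \<Longrightarrow> cnf_less s u" for s t u
  proof (induction s t arbitrary: u rule: cnf_less.induct)
    case (2 c d)
    then show ?case by (cases u) auto
  next
    case (3 a b c d)
    then show ?case by (cases u) auto
  qed simp
  have total: "cnf_less s t \<or> s = t \<or> cnf_less t s" for s t
  proof (induction s t rule: cnf_less.induct)
    case (1 s)
    then show ?case by (cases s) auto
  qed auto
  fix s t u :: cnf
  show "s < t \<longleftrightarrow> s \<le> t \<and> \<not> t \<le> s"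
    using irrefl trans unfolding less_eq_cnf_def less_cnf_def by blast
  show "s \<le> s"
    by (simp add: less_eq_cnf_def)
  show "s \<le> u" if "s \<le> t" "t \<le> u"
    using that trans unfolding less_eq_cnf_def less_cnf_def by blast
  show "s = t" if "s \<le> t" "t \<le> s"
    using that irrefl trans unfolding less_eq_cnf_def less_cnf_def by blast
  show "s \<le> t \<or> t \<le> s"
    using total unfolding less_eq_cnf_def less_cnf_def by blast
qed

end

fun is_cnf :: "cnf \<Rightarrow> bool" where
  "is_cnf Zero = True"
| "is_cnf (OmegaPlus a b) \<longleftrightarrow>
     is_cnf a \<and> is_cnf b \<and> (case b of Zero \<Rightarrow> True | OmegaPlus c d \<Rightarrow> c \<le> a)"

definition omega_pow :: "cnf \<Rightarrow> cnf" where
  "omega_pow a = OmegaPlus a Zero"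

definition omega_pow_times :: "cnf \<Rightarrow> nat \<Rightarrow> cnf" where
  "omega_pow_times a n = (OmegaPlus a ^^ n) Zero"

definition fin_ord :: "nat \<Rightarrow> cnf" where
  "fin_ord n = omega_pow_times Zero n"

definition omega :: cnf where
  "omega = omega_pow (fin_ord 1)"

instantiation cnf :: plus
begin

fun plus_cnf :: "cnf \<Rightarrow> cnf \<Rightarrow> cnf" where
  "Zero + t = t"
| "OmegaPlus a b + t =
     (case t of
        Zero \<Rightarrow> OmegaPlus a b
      | OmegaPlus c d \<Rightarrow> if a < c then t else OmegaPlus a (b + t))"

instance ..

end

text \<open>Natural (Hessenberg) sum and product: the sum merges the two lists of exponents, and the product
  is the bilinear extension of \<open>\<omega>\<^sup>a \<otimes> \<omega>\<^sup>c = \<omega>\<^bsup>a \<oplus> c\<^esup>\<close>.\<close>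

fun nat_sum :: "cnf \<Rightarrow> cnf \<Rightarrow> cnf" (infixl "\<oplus>" 65) where
  "Zero \<oplus> t = t"
| "OmegaPlus a b \<oplus> Zero = OmegaPlus a b"
| "OmegaPlus a b \<oplus> OmegaPlus c d =
     (if a < c then OmegaPlus c (OmegaPlus a b \<oplus> d) else OmegaPlus a (b \<oplus> OmegaPlus c d))"

fun omega_pow_nat_prod :: "cnf \<Rightarrow> cnf \<Rightarrow> cnf" where
  "omega_pow_nat_prod a Zero = Zero"
| "omega_pow_nat_prod a (OmegaPlus c d) = omega_pow (a \<oplus> c) \<oplus> omega_pow_nat_prod a d"

fun nat_prod :: "cnf \<Rightarrow> cnf \<Rightarrow> cnf" (infixl "\<otimes>" 70) where
  "Zero \<otimes> t = Zero"
| "OmegaPlus a b \<otimes> t = omega_pow_nat_prod a t \<oplus> (b \<otimes> t)"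


section \<open>Fundamental sequences and the fast-growing functions\<close>

text \<open>A successor is a term whose last summand is \<open>\<omega>\<^sup>0\<close>; \<open>cnf_pred\<close> removes that summand and is
  only meaningful on successors. \<open>fund_seq\<close> acts on the last summand and is only meaningful on limits.\<close>

fun is_succ :: "cnf \<Rightarrow> bool" where
  "is_succ Zero = False"
| "is_succ (OmegaPlus a b) = (if b = Zero then a = Zero else is_succ b)"

fun cnf_pred :: "cnf \<Rightarrow> cnf" where
  "cnf_pred Zero = Zero"
| "cnf_pred (OmegaPlus a b) = (if b = Zero then Zero else OmegaPlus a (cnf_pred b))"

fun fund_seq :: "cnf \<Rightarrow> nat \<Rightarrow> cnf" where
  "fund_seq Zero x = Zero"
| "fund_seq (OmegaPlus a b) x =
     (if b \<noteq> Zero then OmegaPlus a (fund_seq b x)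
      else if is_succ a then omega_pow_times (cnf_pred a) x
      else omega_pow (fund_seq a x))"

definition cnf_step :: "(cnf \<times> cnf) set" where
  "cnf_step = {(s, t). t \<noteq> Zero \<and> (if is_succ t then s = cnf_pred t else \<exists>x. s = fund_seq t x)}"

primrec cnf_append :: "cnf \<Rightarrow> cnf \<Rightarrow> cnf" where
  "cnf_append Zero t = t"
| "cnf_append (OmegaPlus a b) t = OmegaPlus a (cnf_append b t)"

lemma wf_cnf_step: "wf cnf_step"
proof -
  have step_iff: "(s, t) \<in> cnf_step \<longleftrightarrow>
      t \<noteq> Zero \<and> (if is_succ t then s = cnf_pred t else \<exists>x. s = fund_seq t x)" for s t
    by (simp add: cnf_step_def)
  have append_Zero: "cnf_append c Zero = c" for c
    by (induction c) auto
  have append_nz: "t \<noteq> Zero \<Longrightarrow> cnf_append c t \<noteq> Zero" for c t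
    by (cases c) auto
  have append_succ: "t \<noteq> Zero \<Longrightarrow> is_succ (cnf_append c t) = is_succ t" for c t
    by (induction c) (auto dest: append_nz)
  have append_pred: "t \<noteq> Zero \<Longrightarrow> cnf_pred (cnf_append c t) = cnf_append c (cnf_pred t)" for c t
    by (induction c) (auto dest: append_nz)
  have append_fund: "t \<noteq> Zero \<Longrightarrow> fund_seq (cnf_append c t) x = cnf_append c (fund_seq t x)" for c t x
    by (induction c) (auto dest: append_nz)
  have acc_Zero: "Zero \<in> Wellfounded.acc cnf_step"
    by (rule Wellfounded.accI) (simp add: step_iff)
  have acc_append: "cnf_append c t \<in> Wellfounded.acc cnf_step"
    if "t \<in> Wellfounded.acc cnf_step" and c: "c \<in> Wellfounded.acc cnf_step" for c t
    using that(1)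
  proof (induction rule: acc_induct_rule)
    case (1 t)
    show ?case
    proof (cases "t = Zero")
      case True
      then show ?thesis using c by (simp add: append_Zero)
    next
      case False
      show ?thesis
      proof (rule Wellfounded.accI)
        fix s assume "(s, cnf_append c t) \<in> cnf_step"
        then obtain s' where "(s', t) \<in> cnf_step" "s = cnf_append c s'"
          using False append_succ[OF False] append_pred[OF False] append_fund[OF False]
          by (auto simp: step_iff split: if_splits)
        then show "s \<in> Wellfounded.acc cnf_step" using 1 by auto
      qed
    qed
  qed
  have acc_omega_pow: "omega_pow a \<in> Wellfounded.acc cnf_step" if "a \<in> Wellfounded.acc cnf_step" for a
    using that
  proof (induction rule: acc_induct_rule)
    case (1 a)
    have times: "omega_pow_times a' x \<in> Wellfounded.acc cnf_step" if "omega_pow a' \<in> Wellfounded.acc cnf_step" for a' x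
    proof (induction x)
      case 0
      then show ?case by (simp add: omega_pow_times_def acc_Zero)
    next
      case (Suc x)
      from acc_append[OF Suc that] show ?case
        by (simp add: omega_pow_times_def omega_pow_def)
    qed
    show ?case
    proof (rule Wellfounded.accI)
      fix s assume s: "(s, omega_pow a) \<in> cnf_step"
      consider "a = Zero" | "a \<noteq> Zero" "is_succ a" | "a \<noteq> Zero" "\<not> is_succ a" by blast
      then show "s \<in> Wellfounded.acc cnf_step"
      proof cases
        case 1
        then show ?thesis using s acc_Zero by (simp add: step_iff omega_pow_def)
      next
        case 2
        then have "(cnf_pred a, a) \<in> cnf_step" by (simp add: step_iff)
        then show ?thesis
          using s 2 times[OF "1.IH"] by (auto simp: step_iff omega_pow_def)
      next
        case 3
        then have "(fund_seq a x, a) \<in> cnf_step" for x by (auto simp: step_iff)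
        then have "omega_pow (fund_seq a x) \<in> Wellfounded.acc cnf_step" for x
          using "1.IH" by blast
        then show ?thesis
          using s 3 by (auto simp: step_iff omega_pow_def)
      qed
    qed
  qed
  have "t \<in> Wellfounded.acc cnf_step" for t
  proof (induction t)
    case Zero
    then show ?case by (rule acc_Zero)
  next
    case (OmegaPlus a b)
    from acc_append[OF OmegaPlus(2) acc_omega_pow[OF OmegaPlus(1)]] show ?case
      by (simp add: omega_pow_def)
  qed
  then show ?thesis by (simp add: acc_wfI)
qed

function fast_growing :: "cnf \<Rightarrow> nat \<Rightarrow> nat" where
  "fast_growing \<alpha> =
     (if \<alpha> = Zero then (\<lambda>x. x + 1)
      else if is_succ \<alpha> then (\<lambda>x. (fast_growing (cnf_pred \<alpha>) ^^ x) x)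
      else (\<lambda>x. fast_growing (fund_seq \<alpha> x) x))"
  by auto
termination
  by (relation cnf_step) (rule wf_cnf_step, auto simp: cnf_step_def)

declare fast_growing.simps [simp del]

text \<open>\<open>fast_class \<alpha> k f\<close>: the \<open>k\<close>-ary function \<open>f\<close> belongs to the class of \<open>\<alpha>\<close>. A \<open>k\<close>-ary function is
  represented by a function on lists, of which only the values on lists of length \<open>k\<close> matter.\<close>

inductive fast_class :: "cnf \<Rightarrow> nat \<Rightarrow> (nat list \<Rightarrow> nat) \<Rightarrow> bool" for \<alpha> :: cnf where
  const: "fast_class \<alpha> k (\<lambda>_. c)"
| add: "fast_class \<alpha> 2 (\<lambda>xs. xs ! 0 + xs ! 1)"
| proj: "i < k \<Longrightarrow> fast_class \<alpha> k (\<lambda>xs. xs ! i)"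
| fast: "fast_class \<alpha> 1 (\<lambda>xs. fast_growing \<alpha> (xs ! 0))"
| subst: "fast_class \<alpha> (length hs) f \<Longrightarrow> (\<And>h. h \<in> set hs \<Longrightarrow> fast_class \<alpha> k h) \<Longrightarrow>
    fast_class \<alpha> k (\<lambda>xs. f (map (\<lambda>h. h xs) hs))"
| limited_rec: "fast_class \<alpha> k h0 \<Longrightarrow> fast_class \<alpha> (k + 2) h \<Longrightarrow> fast_class \<alpha> (k + 1) b \<Longrightarrow>
    (\<And>ys. length ys = k \<Longrightarrow> f (0 # ys) = h0 ys) \<Longrightarrow>
    (\<And>y ys. length ys = k \<Longrightarrow> f (Suc y # ys) = h (y # f (y # ys) # ys)) \<Longrightarrow>
    (\<And>xs. length xs = k + 1 \<Longrightarrow> f xs \<le> b xs) \<Longrightarrow>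
    fast_class \<alpha> (k + 1) f"

definition fast_class1 :: "cnf \<Rightarrow> (nat \<Rightarrow> nat) set" where
  "fast_class1 \<alpha> = {\<lambda>x. f [x] |f. fast_class \<alpha> 1 f}"


section \<open>Normed quasi-orders, controlled bad sequences\<close>

record 'a normed_qo =
  carrier :: "'a set"
  le :: "'a \<Rightarrow> 'a \<Rightarrow> bool"
  qnorm :: "'a \<Rightarrow> nat"

definition bad :: "'a normed_qo \<Rightarrow> 'a list \<Rightarrow> bool" where
  "bad A xs \<longleftrightarrow> \<not> (\<exists>i j. i < j \<and> j < length xs \<and> le A (xs ! i) (xs ! j))"

definition controlled :: "'a normed_qo \<Rightarrow> (nat \<Rightarrow> nat) \<Rightarrow> nat \<Rightarrow> 'a list \<Rightarrow> bool" where
  "controlled A g n xs \<longleftrightarrow> (\<forall>i < length xs. qnorm A (xs ! i) < (g ^^ i) n)"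

text \<open>For a wqo \<open>A\<close> with proper norm the set of lengths is finite (Koenig's lemma), and it always
  contains \<open>0\<close>, so \<open>Max\<close> is meaningful.\<close>

definition length_fun :: "'a normed_qo \<Rightarrow> (nat \<Rightarrow> nat) \<Rightarrow> nat \<Rightarrow> nat" where
  "length_fun A g n = Max {length xs |xs. set xs \<subseteq> carrier A \<and> controlled A g n xs \<and> bad A xs}"

definition smooth :: "(nat \<Rightarrow> nat) \<Rightarrow> bool" where
  "smooth g \<longleftrightarrow> (\<forall>x. g (x + 1) \<ge> g x + 1 \<and> g x + 1 \<ge> x + 2)"


section \<open>Exponential nwqos\<close>

text \<open>A single type containing the elements of all exponential nwqos.\<close>

datatype elem = Letter nat | Tagged nat elem | Pair elem elem | Word "elem list"

definition gamma_nwqo :: "nat \<Rightarrow> elem normed_qo" where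
  "gamma_nwqo p = \<lparr>carrier = Letter ` {1..p}, le = (=), qnorm = (\<lambda>_. 0)\<rparr>"

definition sum_nwqo :: "elem normed_qo \<Rightarrow> elem normed_qo \<Rightarrow> elem normed_qo" where
  "sum_nwqo A B = \<lparr>
     carrier = Tagged 1 ` carrier A \<union> Tagged 2 ` carrier B,
     le = (\<lambda>u v. (\<exists>x y. u = Tagged 1 x \<and> v = Tagged 1 y \<and> le A x y) \<or>
                 (\<exists>x y. u = Tagged 2 x \<and> v = Tagged 2 y \<and> le B x y)),
     qnorm = (\<lambda>u. case u of Tagged i x \<Rightarrow> if i = 1 then qnorm A x else qnorm B x | _ \<Rightarrow> 0)\<rparr>"

definition prod_nwqo :: "elem normed_qo \<Rightarrow> elem normed_qo \<Rightarrow> elem normed_qo" where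
  "prod_nwqo A B = \<lparr>
     carrier = {Pair x y |x y. x \<in> carrier A \<and> y \<in> carrier B},
     le = (\<lambda>u v. \<exists>x1 x2 y1 y2. u = Pair x1 x2 \<and> v = Pair y1 y2 \<and> le A x1 y1 \<and> le B x2 y2),
     qnorm = (\<lambda>u. case u of Pair x y \<Rightarrow> max (qnorm A x) (qnorm B y) | _ \<Rightarrow> 0)\<rparr>"

definition star_nwqo :: "elem normed_qo \<Rightarrow> elem normed_qo" where
  "star_nwqo A = \<lparr>
     carrier = Word ` lists (carrier A),
     le = (\<lambda>u v. \<exists>xs ys. u = Word xs \<and> v = Word ys \<and> list_emb (le A) xs ys),
     qnorm = (\<lambda>u. case u of Word xs \<Rightarrow> Max (insert (length xs) (qnorm A ` set xs)) | _ \<Rightarrow> 0)\<rparr>"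

datatype exp_nwqo =
  Gamma nat | GammaStar nat | Sum exp_nwqo exp_nwqo | Prod exp_nwqo exp_nwqo

primrec nwqo_of :: "exp_nwqo \<Rightarrow> elem normed_qo" where
  "nwqo_of (Gamma p) = gamma_nwqo p"
| "nwqo_of (GammaStar p) = star_nwqo (gamma_nwqo p)"
| "nwqo_of (Sum A B) = sum_nwqo (nwqo_of A) (nwqo_of B)"
| "nwqo_of (Prod A B) = prod_nwqo (nwqo_of A) (nwqo_of B)"

text \<open>The maximal order type is taken as computed from the construction of the nwqo.\<close>

primrec max_order_type :: "exp_nwqo \<Rightarrow> cnf" where
  "max_order_type (Gamma p) = fin_ord p"
| "max_order_type (GammaStar p) =
     (case p of 0 \<Rightarrow> fin_ord 1 | Suc q \<Rightarrow> omega_pow (omega_pow (fin_ord q)))"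
| "max_order_type (Sum A B) = max_order_type A \<oplus> max_order_type B"
| "max_order_type (Prod A B) = max_order_type A \<otimes> max_order_type B"

end

theory Submission
  imports Defs
begin

text \<open>If \<open>x\<close> is the first element of a bad sequence, the rest lives in the residual \<open>{y. \<not> x \<le> y}\<close>. A
  residual of a sum of products of word orderings reflects into another such sum of smaller order
  type, because the words avoiding \<open>a\<^sub>1\<dots>a\<^sub>k\<close> split into at most \<open>k\<close> factors, each over an alphabet with
  one letter less; the new term has size polynomial in the old one and in the norm of \<open>x\<close>. Hence the
  length is bounded by a Hardy function \<open>h\<^sub>\<alpha>\<close> with \<open>\<alpha> = o(A)\<close>, where \<open>h\<close> absorbs both \<open>g\<close> and this
  polynomial. Since \<open>h\<close> at \<open>\<omega>\<^sup>\<beta>\<close> is the fast-growing function of level \<open>\<beta>\<close> relative to the base \<open>h\<close>,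
  taking an iterate of \<open>F\<^sub>\<gamma>\<close> for \<open>h\<close> gives iterates of \<open>F\<close> at level \<open>\<gamma> + \<beta>\<close>.\<close>

section \<open>Pointwise descent on Cantor normal forms\<close>

text \<open>The obstacle is that Hardy functions are not monotone in the index: at \<omega> the
  value at \<open>x\<close> is the \<open>x\<close>-fold iterate of \<open>h\<close>, which a finite
  index \<open>n > x\<close> exceeds. A smaller index is safe when it is reached by descent at the
  current argument, and this is guaranteed once the argument exceeds the size of the smaller term.
  Hence sizes are tracked along the bad sequence, and each call of \<open>h\<close> must restore an
  argument large enough for the next comparison. The base is an iterate of F at a level \<delta>
  \<ge> 2, because level 2 is the first finite level that dominates squaring. For finite \<beta>
  take \<delta> = \<gamma>; level \<beta> over that base is exactly level \<gamma> + \<beta>. For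
  finite \<gamma> and \<beta> \<ge> \<omega> take \<delta> = \<gamma> + 2; then \<delta> + \<beta> =
  \<beta> leads back to level \<beta>. The order type enters only through its exponents: an index
  below \<open>omega_pow_times \<beta> N\<close> costs a constant multiple of \<open>N\<close>
  iterates at level \<beta>, which stay inside the class.\<close>

lemma cnf_less_simps [simp]:
  "\<not> s < Zero"
  "Zero < OmegaPlus c d"
  "OmegaPlus a b < OmegaPlus c d \<longleftrightarrow> a < c \<or> a = c \<and> b < d"
  by (auto simp: less_cnf_def)

lemma Zero_le_cnf [simp]: "Zero \<le> (s :: cnf)"
  by (cases s) (auto simp: less_eq_cnf_def)

lemma le_Zero_cnf_iff [simp]: "s \<le> Zero \<longleftrightarrow> s = Zero"
  by (auto simp: less_eq_cnf_def)

lemma Zero_neq_iff: "Zero \<noteq> s \<longleftrightarrow> Zero < s"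
  by (cases s) auto

lemma OmegaPlus_le_iff [simp]:
  "OmegaPlus a b \<le> OmegaPlus c d \<longleftrightarrow> a < c \<or> a = c \<and> b \<le> d"
  by (auto simp: less_eq_cnf_def)

lemma cnf_append_Zero [simp]: "cnf_append c Zero = c"
  by (induction c) auto

lemma cnf_append_eq_Zero_iff [simp]: "cnf_append c t = Zero \<longleftrightarrow> c = Zero \<and> t = Zero"
  by (cases c) auto

lemma is_succ_append [simp]: "t \<noteq> Zero \<Longrightarrow> is_succ (cnf_append c t) = is_succ t"
  by (induction c) auto

lemma cnf_pred_append [simp]: "t \<noteq> Zero \<Longrightarrow> cnf_pred (cnf_append c t) = cnf_append c (cnf_pred t)"
  by (induction c) auto

lemma fund_seq_append [simp]:
  "t \<noteq> Zero \<Longrightarrow> fund_seq (cnf_append c t) x = cnf_append c (fund_seq t x)"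
  by (induction c) auto

lemma omega_pow_times_0 [simp]: "omega_pow_times a 0 = Zero"
  and omega_pow_times_Suc [simp]: "omega_pow_times a (Suc n) = OmegaPlus a (omega_pow_times a n)"
  by (auto simp: omega_pow_times_def)

lemma omega_pow_times_add:
  "omega_pow_times a (m + n) = cnf_append (omega_pow_times a m) (omega_pow_times a n)"
  by (induction m) auto

text \<open>One step of the pointwise ordering of ordinals: \<open>z\<close> stays fixed during the
  whole descent, while \<open>hardy\<close> changes its argument at successors.\<close>

definition step_at :: "nat \<Rightarrow> cnf \<Rightarrow> cnf \<Rightarrow> bool" where
  "step_at z t s \<longleftrightarrow> t \<noteq> Zero \<and> s = (if is_succ t then cnf_pred t else fund_seq t z)"

abbreviation reach :: "nat \<Rightarrow> cnf \<Rightarrow> cnf \<Rightarrow> bool" where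
  "reach z \<equiv> (step_at z)\<^sup>*\<^sup>*"

lemma step_at_cnf_step: "step_at z t s \<Longrightarrow> (s, t) \<in> cnf_step"
  by (auto simp: step_at_def cnf_step_def)

lemma step_at_append: "step_at z t s \<Longrightarrow> step_at z (cnf_append c t) (cnf_append c s)"
  by (auto simp: step_at_def)

lemma reach_append: "reach z t s \<Longrightarrow> reach z (cnf_append c t) (cnf_append c s)"
  by (induction rule: rtranclp_induct) (auto intro: rtranclp.rtrancl_into_rtrancl step_at_append)

lemma reach_Zero: "reach z t Zero"
proof (induction t rule: wf_induct_rule[OF wf_cnf_step])
  case (1 t)
  show ?case
  proof (cases "t = Zero")
    case False
    then have "step_at z t (if is_succ t then cnf_pred t else fund_seq t z)" (is "step_at z t ?s")
      by (simp add: step_at_def)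
    with 1 show ?thesis by (meson converse_rtranclp_into_rtranclp step_at_cnf_step)
  qed simp
qed

lemma reach_prefix: "reach z (cnf_append c t) c"
  using reach_append[OF reach_Zero, of z c t] by simp

text \<open>At a successor exponent the step leads to \<open>z\<close> copies of the power of the
  predecessor; descending through all but the first leaves that power, and \<open>1 \<le> z\<close>
  provides the first copy.\<close>

lemma reach_omega_pow:
  assumes "1 \<le> z" "reach z a a'"
  shows "reach z (omega_pow a) (omega_pow a')"
  using assms(2)
proof (induction rule: rtranclp_induct)
  case (step s t)
  have "reach z (omega_pow s) (omega_pow t)"
  proof (cases "is_succ s")
    case True
    obtain z' where z': "z = Suc z'" using assms(1) by (cases z) auto
    have "s \<noteq> Zero" "t = cnf_pred s" using True step(2) by (auto simp: step_at_def)
    then have "step_at z (omega_pow s) (cnf_append (omega_pow t) (omega_pow_times t z'))"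
      using True z' by (auto simp: step_at_def omega_pow_def)
    then show ?thesis using reach_prefix by (meson converse_rtranclp_into_rtranclp)
  next
    case False
    then have "step_at z (omega_pow s) (omega_pow t)"
      using step(2) by (auto simp: step_at_def omega_pow_def)
    then show ?thesis by simp
  qed
  with step(3) show ?case by simp
qed simp

text \<open>Over a successor exponent the later member is the earlier one with further copies
  appended; over a limit exponent \<open>reach_omega_pow\<close> lifts the descent from exponents to
  powers.\<close>

lemma reach_fund_seq:
  assumes "1 \<le> z" "x \<le> y" "t \<noteq> Zero" "\<not> is_succ t"
  shows "reach z (fund_seq t y) (fund_seq t x)"
  using assms(3,4)
proof (induction t)
  case (OmegaPlus a b)
  show ?case
  proof (cases "b = Zero")
    case False
    then have "reach z (fund_seq b y) (fund_seq b x)"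
      using OmegaPlus by auto
    from reach_append[OF this, of "omega_pow a"] False show ?thesis
      by (simp add: omega_pow_def)
  next
    case True
    with OmegaPlus have a: "a \<noteq> Zero" by auto
    show ?thesis
    proof (cases "is_succ a")
      case True
      obtain k where "y = x + k" using assms(2) le_Suc_ex by blast
      with True \<open>b = Zero\<close> show ?thesis
        using reach_prefix by (simp add: omega_pow_times_add)
    next
      case False
      with a OmegaPlus(1) \<open>b = Zero\<close> show ?thesis
        using reach_omega_pow[OF assms(1)] by simp
    qed
  qed
qed simp

section \<open>Small terms are reached by descent\<close>

lemma less_succ_imp_le_pred: "\<alpha> < \<beta> \<Longrightarrow> is_succ \<beta> \<Longrightarrow> \<alpha> \<le> cnf_pred \<beta>"
proof (induction \<beta> arbitrary: \<alpha>)
  case (OmegaPlus a b)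
  then show ?case by (cases \<alpha>) (auto split: if_splits)
qed simp

text \<open>\<open>size\<close> bounds the number of summands, so \<open>\<alpha>\<close> has fewer
  than \<open>n\<close> of them, none with an exponent above \<open>b\<close>.\<close>

lemma less_omega_pow_times:
  assumes "is_cnf \<alpha>" "size \<alpha> < n" "\<And>c d. \<alpha> = OmegaPlus c d \<Longrightarrow> c \<le> b"
  shows "\<alpha> < omega_pow_times b n"
  using assms
proof (induction \<alpha> arbitrary: n)
  case Zero
  then show ?case by (cases n) auto
next
  case (OmegaPlus c d)
  obtain m where m: "n = Suc m" using OmegaPlus(4) by (cases n) auto
  have "c \<le> b" using OmegaPlus.prems(3) by blast
  moreover have "d < omega_pow_times b m"
  proof (rule OmegaPlus.IH)
    show "c' \<le> b" if "d = OmegaPlus c' d'" for c' d'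
      using that OmegaPlus.prems(1) \<open>c \<le> b\<close> by auto
  qed (use OmegaPlus.prems(1,2) m in auto)
  ultimately show ?case using m by auto
qed

text \<open>\<open>size \<alpha>\<close> controls both the number of summands of
  \<open>\<alpha>\<close>, as a successor exponent needs, and the size of its leading exponent, as
  the recursion at a limit exponent needs.\<close>

lemma less_fund_seq:
  assumes "is_cnf \<alpha>" "\<alpha> < \<beta>" "\<not> is_succ \<beta>" "size \<alpha> < x"
  shows "\<alpha> < fund_seq \<beta> x"
  using assms
proof (induction \<beta> arbitrary: \<alpha>)
  case (OmegaPlus a b)
  show ?case
  proof (cases "b = Zero")
    case False
    then show ?thesis using OmegaPlus by (cases \<alpha>) auto
  next
    case True
    with OmegaPlus have a: "a \<noteq> Zero" by auto
    have head: "c < a" "is_cnf c" "size c < x" if "\<alpha> = OmegaPlus c d" for c d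
      using that OmegaPlus.prems True by auto
    show ?thesis
    proof (cases "is_succ a")
      case succ: True
      have "\<alpha> < omega_pow_times (cnf_pred a) x"
        using OmegaPlus.prems(1,4) less_succ_imp_le_pred[OF head(1) succ]
        by (intro less_omega_pow_times)
      then show ?thesis using True succ by simp
    next
      case False
      then show ?thesis using True head OmegaPlus.IH(1)
        by (cases \<alpha>) (auto simp: omega_pow_def)
    qed
  qed
qed simp

text \<open>A descent step at \<open>x\<close> from strictly above \<open>\<alpha>\<close> cannot
  jump below \<open>\<alpha>\<close>, and descent terminates, so it passes through
  \<open>\<alpha>\<close>.\<close>

lemma reach_if_small:
  assumes "is_cnf \<alpha>" "\<alpha> \<le> \<beta>" "size \<alpha> < x"
  shows "reach x \<beta> \<alpha>"
  using assms(2)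
proof (induction \<beta> rule: wf_induct_rule[OF wf_cnf_step])
  case (1 \<beta>)
  show ?case
  proof (cases "\<alpha> = \<beta>")
    case False
    with 1 have less: "\<alpha> < \<beta>" by simp
    define s where "s = (if is_succ \<beta> then cnf_pred \<beta> else fund_seq \<beta> x)"
    have "step_at x \<beta> s" using less by (auto simp: s_def step_at_def)
    moreover have "\<alpha> \<le> s"
      using less_succ_imp_le_pred less_fund_seq[OF assms(1) less _ assms(3)] less
      by (auto simp: s_def)
    ultimately show ?thesis using 1 by (meson converse_rtranclp_into_rtranclp step_at_cnf_step)
  qed simp
qed


section \<open>The Hardy hierarchy\<close>

function hardy :: "(nat \<Rightarrow> nat) \<Rightarrow> cnf \<Rightarrow> nat \<Rightarrow> nat" where
  "hardy h \<alpha> =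
     (if \<alpha> = Zero then (\<lambda>x. x)
      else if is_succ \<alpha> then (\<lambda>x. hardy h (cnf_pred \<alpha>) (h x))
      else (\<lambda>x. hardy h (fund_seq \<alpha> x) x))"
  by auto
termination
  by (relation "inv_image cnf_step snd") (rule wf_inv_image[OF wf_cnf_step], auto simp: cnf_step_def)

declare hardy.simps [simp del]

lemma hardy_Zero [simp]: "hardy h Zero x = x"
  by (simp add: hardy.simps[of h Zero])

lemma hardy_succ: "is_succ \<alpha> \<Longrightarrow> hardy h \<alpha> x = hardy h (cnf_pred \<alpha>) (h x)"
  by (cases "\<alpha> = Zero") (auto simp: hardy.simps[of h \<alpha>])

lemma hardy_limit: "\<not> is_succ \<alpha> \<Longrightarrow> \<alpha> \<noteq> Zero \<Longrightarrow> hardy h \<alpha> x = hardy h (fund_seq \<alpha> x) x"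
  by (auto simp: hardy.simps[of h \<alpha>])

lemma cnf_step_pred: "is_succ \<alpha> \<Longrightarrow> (cnf_pred \<alpha>, \<alpha>) \<in> cnf_step"
  by (cases "\<alpha> = Zero") (auto simp: cnf_step_def)

lemma cnf_step_fund_seq: "\<not> is_succ \<alpha> \<Longrightarrow> \<alpha> \<noteq> Zero \<Longrightarrow> (fund_seq \<alpha> x, \<alpha>) \<in> cnf_step"
  by (auto simp: cnf_step_def)

text \<open>Outside normal forms \<open><\<close> is not well-founded (prepending
  \<open>Zero\<close> exponents to \<open>omega\<close> descends forever), so inductions follow
  \<open>cnf_step\<close>, which is well-founded on all terms.\<close>

lemma cnf_cases_induct [case_names Zero succ limit]:
  assumes "P Zero"
    and "\<And>\<alpha>. is_succ \<alpha> \<Longrightarrow> P (cnf_pred \<alpha>) \<Longrightarrow> P \<alpha>"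
    and "\<And>\<alpha>. \<not> is_succ \<alpha> \<Longrightarrow> \<alpha> \<noteq> Zero \<Longrightarrow> (\<And>x. P (fund_seq \<alpha> x)) \<Longrightarrow> P \<alpha>"
  shows "P \<alpha>"
proof (induction \<alpha> rule: wf_induct_rule[OF wf_cnf_step])
  case (1 \<alpha>)
  then show ?case using assms cnf_step_pred cnf_step_fund_seq by metis
qed

lemma hardy_append: "hardy h (cnf_append a b) x = hardy h a (hardy h b x)"
proof (induction b arbitrary: x rule: cnf_cases_induct)
  case (succ b)
  then have "b \<noteq> Zero" by auto
  with succ show ?case by (simp add: hardy_succ)
next
  case (limit b)
  then show ?case by (simp add: hardy_limit)
qed simp

text \<open>The two claims need each other: monotonicity at a limit compares two members of the
  fundamental sequence by descent, and a descent step at a successor drops one application of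
  \<open>h\<close>, which costs monotonicity at the predecessor.\<close>

lemma hardy_mono_and_reach:
  assumes h: "mono h" "\<And>x. x \<le> h x"
  shows "mono (hardy h \<alpha>) \<and> (\<forall>z t. reach z \<alpha> t \<longrightarrow> hardy h t z \<le> hardy h \<alpha> z)"
proof (induction \<alpha> rule: wf_induct_rule[OF wf_cnf_step])
  case (1 \<alpha>)
  have "hardy h t z \<le> hardy h \<alpha> z" if "reach z \<alpha> t" for z t
    using that
  proof (cases rule: converse_rtranclpE)
    case (step s)
    then have s: "mono (hardy h s)" "hardy h t z \<le> hardy h s z"
      using 1 step_at_cnf_step by blast+
    have "hardy h s z \<le> hardy h \<alpha> z"
      using step(1) monoD[OF s(1) h(2)[of z]] by (auto simp: step_at_def hardy_succ hardy_limit)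
    with s show ?thesis by linarith
  qed simp
  moreover have "mono (hardy h \<alpha>)"
  proof (cases "\<alpha> = Zero \<or> is_succ \<alpha>")
    case True
    then show ?thesis
    proof
      assume "is_succ \<alpha>"
      with 1[OF cnf_step_pred] h(1) show ?thesis by (auto simp: mono_def hardy_succ)
    qed (auto simp: mono_def)
  next
    case False
    show ?thesis
    proof (rule monoI)
      fix x y :: nat assume "x \<le> y"
      show "hardy h \<alpha> x \<le> hardy h \<alpha> y"
      \<comment> \<open>For \<open>x < y\<close> the argument \<open>y\<close> is at least 1, as
        \<open>reach_fund_seq\<close> requires.\<close>
      proof (cases "x = y")
        case neq: False
        have "hardy h (fund_seq \<alpha> x) x \<le> hardy h (fund_seq \<alpha> x) y"
          using 1 cnf_step_fund_seq False \<open>x \<le> y\<close> by (meson monoD)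
        also have "\<dots> \<le> hardy h (fund_seq \<alpha> y) y"
          using 1 cnf_step_fund_seq reach_fund_seq False \<open>x \<le> y\<close> neq by auto
        finally show ?thesis using False by (simp add: hardy_limit)
      qed simp
    qed
  qed
  ultimately show ?case by blast
qed

lemma hardy_strict_mono:
  assumes "strict_mono h"
  shows "strict_mono (hardy h \<alpha>)"
proof (induction \<alpha> rule: cnf_cases_induct)
  case Zero
  then show ?case by (simp add: strict_mono_def)
next
  case (succ \<alpha>)
  then show ?case using assms by (simp add: strict_mono_def hardy_succ)
next
  case (limit \<alpha>)
  have h: "mono h" "\<And>x. x \<le> h x"
    using assms strict_mono_imp_increasing strict_mono_mono by auto
  show ?case
  proof (rule strict_monoI)
    fix x y :: nat assume "x < y"
    then have "hardy h (fund_seq \<alpha> x) x < hardy h (fund_seq \<alpha> x) y"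
      using limit by (simp add: strict_mono_def)
    also have "\<dots> \<le> hardy h (fund_seq \<alpha> y) y"
      using hardy_mono_and_reach[OF h] reach_fund_seq limit \<open>x < y\<close> by auto
    finally show "hardy h \<alpha> x < hardy h \<alpha> y"
      using limit by (simp add: hardy_limit)
  qed
qed

section \<open>The fast-growing hierarchy over an arbitrary base function\<close>

abbreviation fast_rel :: "(nat \<Rightarrow> nat) \<Rightarrow> cnf \<Rightarrow> nat \<Rightarrow> nat" where
  "fast_rel h \<alpha> \<equiv> hardy h (omega_pow \<alpha>)"

lemma hardy_omega_pow_times: "hardy h (omega_pow_times a n) = fast_rel h a ^^ n"
proof (induction n)
  case (Suc n)
  have "hardy h (omega_pow_times a (Suc n)) x = fast_rel h a (hardy h (omega_pow_times a n) x)" for x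
    using hardy_append[of h "omega_pow a" "omega_pow_times a n" x] by (simp add: omega_pow_def)
  with Suc show ?case by auto
qed auto

lemma fast_rel_Zero: "fast_rel h Zero = h"
proof
  have "is_succ (omega_pow Zero)" "cnf_pred (omega_pow Zero) = Zero" by (auto simp: omega_pow_def)
  then show "fast_rel h Zero x = h x" for x by (simp add: hardy_succ)
qed

lemma fast_rel_succ: "is_succ \<alpha> \<Longrightarrow> fast_rel h \<alpha> x = (fast_rel h (cnf_pred \<alpha>) ^^ x) x"
proof -
  assume "is_succ \<alpha>"
  then have "\<not> is_succ (omega_pow \<alpha>)" "omega_pow \<alpha> \<noteq> Zero"
    "fund_seq (omega_pow \<alpha>) x = omega_pow_times (cnf_pred \<alpha>) x"
    by (auto simp: omega_pow_def)
  then show ?thesis by (simp add: hardy_limit hardy_omega_pow_times)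
qed

lemma fast_rel_limit: "\<not> is_succ \<alpha> \<Longrightarrow> \<alpha> \<noteq> Zero \<Longrightarrow> fast_rel h \<alpha> x = fast_rel h (fund_seq \<alpha> x) x"
proof -
  assume *: "\<not> is_succ \<alpha>" "\<alpha> \<noteq> Zero"
  then have "\<not> is_succ (omega_pow \<alpha>)" "omega_pow \<alpha> \<noteq> Zero"
    "fund_seq (omega_pow \<alpha>) x = omega_pow (fund_seq \<alpha> x)"
    by (auto simp: omega_pow_def)
  then show ?thesis by (simp add: hardy_limit)
qed

text \<open>Fundamental sequences of powers match the recursion of the fast-growing functions, since
  \<open>hardy\<close> turns sums of powers into compositions; the base \<open>Suc\<close> supplies
  level zero.\<close>

lemma fast_growing_eq_fast_rel: "fast_growing \<alpha> = fast_rel Suc \<alpha>"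
proof (induction \<alpha> rule: cnf_cases_induct)
  case Zero
  then show ?case by (auto simp: fast_growing.simps[of Zero] fast_rel_Zero)
next
  case (succ \<alpha>)
  then have "\<alpha> \<noteq> Zero" by auto
  with succ show ?case by (auto simp: fast_growing.simps[of \<alpha>] fast_rel_succ)
next
  case (limit \<alpha>)
  then show ?case by (auto simp: fast_growing.simps[of \<alpha>] fast_rel_limit)
qed

lemma funpow_mono_fun:
  fixes f f' :: "nat \<Rightarrow> nat"
  assumes "mono f'" "\<And>v. x \<le> v \<Longrightarrow> f v \<le> f' v" "\<And>v. v \<le> f v" "x \<le> y"
  shows "(f ^^ n) x \<le> (f' ^^ n) y"
proof -
  have "x \<le> (f ^^ n) x \<and> (f ^^ n) x \<le> (f' ^^ n) y"
  proof (induction n)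
    case (Suc n)
    then have "f ((f ^^ n) x) \<le> f' ((f ^^ n) x)" using assms(2) by blast
    also have "\<dots> \<le> f' ((f' ^^ n) y)" using Suc assms(1) by (auto dest: monoD)
    finally show ?case using Suc assms(3)[of "(f ^^ n) x"] by auto
  qed (use assms(4) in simp)
  then show ?thesis by blast
qed

lemma funpow_increasing:
  fixes f :: "nat \<Rightarrow> nat"
  assumes "\<And>v. v \<le> f v"
  shows "x \<le> (f ^^ n) x"
proof (induction n)
  case (Suc n)
  then show ?case using assms[of "(f ^^ n) x"] by simp
qed simp

lemma funpow_increasing_le:
  fixes f :: "nat \<Rightarrow> nat"
  assumes "\<And>v. v \<le> f v" "m \<le> n"
  shows "(f ^^ m) x \<le> (f ^^ n) x"
proof -
  have "(f ^^ n) x = (f ^^ (n - m)) ((f ^^ m) x)"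
    using assms(2) by (metis add_diff_inverse_nat add.commute comp_apply funpow_add not_less)
  then show ?thesis using funpow_increasing[OF assms(1)] by simp
qed

lemma funpow_increasing2:
  fixes f :: "nat \<Rightarrow> nat"
  assumes "mono f" "\<And>v. v \<le> f v" "m \<le> n" "x \<le> y"
  shows "(f ^^ m) x \<le> (f ^^ n) y"
  using funpow_increasing_le[of f m n x] funpow_mono_fun[of f x f y n] assms by (meson le_trans order_refl)

text \<open>Strict growth is demanded only from 1 on because the fast-growing functions, which serve
  as bases, vanish at 0 at every successor level.\<close>

locale increasing =
  fixes h :: "nat \<Rightarrow> nat"
  assumes strict_mono_h: "strict_mono h" and greater_h: "1 \<le> x \<Longrightarrow> x < h x"
begin

lemma mono_h: "mono h" and ge_h: "x \<le> h x"
  using strict_mono_h strict_mono_mono strict_mono_imp_increasing by auto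

lemma mono_hardy: "mono (hardy h \<alpha>)"
  using hardy_mono_and_reach[OF mono_h ge_h] by blast

lemma hardy_le_hardy: "x \<le> y \<Longrightarrow> hardy h \<alpha> x \<le> hardy h \<alpha> y"
  using mono_hardy monoD by blast

lemma hardy_reach: "reach z \<alpha> t \<Longrightarrow> hardy h t z \<le> hardy h \<alpha> z"
  using hardy_mono_and_reach[OF mono_h ge_h] by blast

lemma hardy_ge: "x \<le> hardy h \<alpha> x"
  using strict_mono_imp_increasing[OF hardy_strict_mono[OF strict_mono_h]] by simp

lemma hardy_small:
  "is_cnf \<alpha> \<Longrightarrow> \<alpha> \<le> \<beta> \<Longrightarrow> size \<alpha> < x \<Longrightarrow> hardy h \<alpha> x \<le> hardy h \<beta> x"
  by (simp add: reach_if_small hardy_reach)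

lemma fast_rel_small:
  "is_cnf \<alpha> \<Longrightarrow> \<alpha> \<le> \<beta> \<Longrightarrow> size \<alpha> < x \<Longrightarrow> fast_rel h \<alpha> x \<le> fast_rel h \<beta> x"
  by (intro hardy_reach reach_omega_pow reach_if_small) auto

lemma fast_rel_greater: "1 \<le> x \<Longrightarrow> x < fast_rel h \<alpha> x"
proof (induction \<alpha> rule: cnf_cases_induct)
  case Zero
  then show ?case by (simp add: fast_rel_Zero greater_h)
next
  case (succ \<alpha>)
  have "(fast_rel h (cnf_pred \<alpha>) ^^ 1) x \<le> (fast_rel h (cnf_pred \<alpha>) ^^ x) x"
    using succ.prems hardy_ge by (intro funpow_increasing_le) auto
  with succ show ?case by (simp add: fast_rel_succ)
next
  case (limit \<alpha>)
  then show ?case by (simp add: fast_rel_limit)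
qed

lemma fast_rel_succ_double:
  assumes "is_succ \<alpha>"
  shows "2 * x \<le> fast_rel h \<alpha> x"
proof (cases "x = 0")
  case False
  have "x + n \<le> (fast_rel h (cnf_pred \<alpha>) ^^ n) x" for n
  proof (induction n)
    case (Suc n)
    then show ?case
      using fast_rel_greater[of "(fast_rel h (cnf_pred \<alpha>) ^^ n) x" "cnf_pred \<alpha>"] False by auto
  qed simp
  from this[of x] show ?thesis using assms by (simp add: fast_rel_succ mult_2)
qed simp

text \<open>An iteration started at \<open>x\<close> evaluates the fixed level
  \<open>fund_seq \<alpha> x\<close> at growing arguments \<open>v\<close>, where the diagonal index
  is \<open>v\<close>; nestedness of the fundamental sequence compares the two.\<close>

lemma fast_rel_fund_seq_le:
  assumes "\<not> is_succ \<alpha>" "\<alpha> \<noteq> Zero" "x \<le> v"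
  shows "fast_rel h (fund_seq \<alpha> x) v \<le> fast_rel h \<alpha> v"
proof (cases "x = v")
  case False
  with assms have "reach v (fund_seq \<alpha> v) (fund_seq \<alpha> x)"
    by (intro reach_fund_seq) auto
  then have "fast_rel h (fund_seq \<alpha> x) v \<le> fast_rel h (fund_seq \<alpha> v) v"
    using assms False by (intro hardy_reach reach_omega_pow) auto
  then show ?thesis using assms fast_rel_limit by simp
qed (use assms fast_rel_limit in simp)

lemma increasing_funpow: "1 \<le> c \<Longrightarrow> increasing (h ^^ c)"
proof
  show "strict_mono (h ^^ c)"
    by (induction c) (use strict_mono_h in \<open>auto simp: strict_mono_def\<close>)
  show "x < (h ^^ c) x" if "1 \<le> c" "1 \<le> x" for x
    using funpow_increasing_le[OF ge_h that(1), of x] greater_h[OF that(2)] by simp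
qed

text \<open>Iterating the base function \<open>c\<close> times costs only \<open>c\<close> iterations at every level: at a successor
  the argument grows to \<open>c * x\<close>, which is absorbed because \<open>fast_rel h (\<alpha> + 1)\<close> doubles.\<close>

lemma fast_rel_funpow:
  assumes "1 \<le> c"
  shows "fast_rel (h ^^ c) \<alpha> x \<le> (fast_rel h \<alpha> ^^ c) x"
proof (induction \<alpha> arbitrary: x rule: cnf_cases_induct)
  case Zero
  then show ?case by (simp add: fast_rel_Zero)
next
  case (succ \<alpha>)
  interpret c: increasing "h ^^ c" by (rule increasing_funpow[OF assms])
  let ?f = "fast_rel h (cnf_pred \<alpha>)"
  obtain d where d: "c = Suc d" using assms by (cases c) auto
  have dbl: "n * x + x \<le> (fast_rel h \<alpha> ^^ n) x" for n
  proof (induction n)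
    case (Suc n)
    have "Suc n * x + x \<le> 2 * ((fast_rel h \<alpha> ^^ n) x)" using Suc by auto
    also have "\<dots> \<le> fast_rel h \<alpha> ((fast_rel h \<alpha> ^^ n) x)" using fast_rel_succ_double succ by blast
    finally show ?case by simp
  qed simp
  have "fast_rel (h ^^ c) \<alpha> x = (fast_rel (h ^^ c) (cnf_pred \<alpha>) ^^ x) x"
    using succ by (simp add: fast_rel_succ)
  also have "\<dots> \<le> ((?f ^^ c) ^^ x) x"
    using succ c.hardy_ge by (intro funpow_mono_fun) (auto intro: mono_pow mono_hardy)
  also have "\<dots> \<le> (?f ^^ (c * x)) (c * x)"
    unfolding funpow_mult using d by (intro funpow_increasing2 mono_hardy hardy_ge) auto
  also have "\<dots> = fast_rel h \<alpha> (c * x)" using succ by (simp add: fast_rel_succ)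
  \<comment> \<open>With \<open>c = d + 1\<close>, \<open>d\<close> applications at level
    \<open>\<alpha>\<close> reach \<open>c * x\<close>, and the pending one makes \<open>c\<close>
    in all.\<close>
  also have "\<dots> \<le> fast_rel h \<alpha> ((fast_rel h \<alpha> ^^ d) x)"
    using dbl[of d] d by (intro hardy_le_hardy) (simp add: add.commute)
  also have "\<dots> = (fast_rel h \<alpha> ^^ c) x" by (simp add: d)
  finally show ?case .
next
  case (limit \<alpha>)
  have "fast_rel (h ^^ c) \<alpha> x \<le> (fast_rel h (fund_seq \<alpha> x) ^^ c) x"
    using limit by (simp add: fast_rel_limit)
  also have "\<dots> \<le> (fast_rel h \<alpha> ^^ c) x"
    using limit by (intro funpow_mono_fun mono_hardy fast_rel_fund_seq_le hardy_ge) auto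
  finally show ?case .
qed

end

section \<open>Finite levels and absorption over the base \<open>Suc\<close>\<close>

interpretation Suc: increasing Suc
  by unfold_locales (auto simp: strict_mono_def)

lemma increasing_fast_growing: "increasing (fast_growing \<alpha>)"
  unfolding fast_growing_eq_fast_rel
  by unfold_locales (auto intro: hardy_strict_mono Suc.strict_mono_h Suc.fast_rel_greater)

lemma fast_growing_succ: "is_succ \<alpha> \<Longrightarrow> fast_growing \<alpha> x = (fast_growing (cnf_pred \<alpha>) ^^ x) x"
  by (simp add: fast_growing_eq_fast_rel fast_rel_succ)

lemma fin_ord_simps [simp]: "fin_ord 0 = Zero" "fin_ord (Suc n) = OmegaPlus Zero (fin_ord n)"
  by (auto simp: fin_ord_def)

lemma is_succ_fin_ord: "is_succ (fin_ord (Suc n))"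
  and cnf_pred_fin_ord: "cnf_pred (fin_ord (Suc n)) = fin_ord n"
  and fin_ord_Suc_neq_Zero: "fin_ord (Suc n) \<noteq> Zero"
  by (induction n) auto

lemma size_fin_ord [simp]: "size (fin_ord n) = n"
  by (induction n) auto

lemma is_cnf_fin_ord [simp]: "is_cnf (fin_ord n)"
proof (induction n)
  case (Suc n)
  then show ?case by (cases n) auto
qed simp

lemma fin_ord_less_iff [simp]: "fin_ord m < fin_ord n \<longleftrightarrow> m < n"
proof (induction m arbitrary: n)
  case 0
  then show ?case by (cases n) auto
next
  case (Suc m)
  then show ?case by (cases n) auto
qed

lemma plus_fin_ord: "\<gamma> + fin_ord k = cnf_append \<gamma> (fin_ord k)"
proof (induction \<gamma>)
  case (OmegaPlus a b)
  then show ?case by (cases k) auto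
qed simp

lemma fin_ord_append: "cnf_append (fin_ord m) (fin_ord n) = fin_ord (m + n)"
  by (induction m) auto

text \<open>Both sides start from \<open>fast_growing \<gamma>\<close> and take the same successor
  step, so the base contributes its level as a left summand.\<close>

lemma fast_rel_fast_growing_fin_ord:
  "fast_rel (fast_growing \<gamma>) (fin_ord k) = fast_growing (cnf_append \<gamma> (fin_ord k))"
proof (induction k)
  case 0
  then show ?case by (simp add: fast_rel_Zero)
next
  case (Suc k)
  note fin = is_succ_fin_ord[of k] cnf_pred_fin_ord[of k] fin_ord_Suc_neq_Zero[of k]
  show ?case
    by (rule ext) (simp add: fast_rel_succ fast_growing_succ fin Suc del: fin_ord_simps)
qed

lemma fast_growing_mono: "x \<le> y \<Longrightarrow> fast_growing \<alpha> x \<le> fast_growing \<alpha> y"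
  by (simp add: fast_growing_eq_fast_rel Suc.hardy_le_hardy)

lemma fast_growing_ge: "x \<le> fast_growing \<alpha> x"
  by (simp add: fast_growing_eq_fast_rel Suc.hardy_ge)

lemma fast_growing_small:
  "is_cnf \<alpha> \<Longrightarrow> \<alpha> \<le> \<beta> \<Longrightarrow> size \<alpha> < x \<Longrightarrow> fast_growing \<alpha> x \<le> fast_growing \<beta> x"
  by (simp add: fast_growing_eq_fast_rel Suc.fast_rel_small)

text \<open>Level 2 is \<open>2 ^ x * x\<close>; passing to \<open>\<delta>\<close> needs
  \<open>x\<close> above the size 2 of \<open>fin_ord 2\<close>.\<close>

lemma fast_growing_ge_square:
  assumes "fin_ord 2 \<le> \<delta>" "4 \<le> x"
  shows "x\<^sup>2 \<le> fast_growing \<delta> x"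
proof -
  have F0: "fast_growing Zero v = Suc v" for v
    by (simp add: fast_growing_eq_fast_rel fast_rel_Zero)
  have "(fast_growing Zero ^^ n) v = v + n" for n v
    by (induction n) (auto simp: F0)
  then have F1: "fast_growing (fin_ord 1) v = 2 * v" for v
    by (simp add: fast_growing_succ)
  have "(fast_growing (fin_ord 1) ^^ n) v = 2 ^ n * v" for n v
    by (induction n) (simp_all add: F1 del: fin_ord_simps One_nat_def)
  then have F2: "fast_growing (fin_ord 2) x = 2 ^ x * x"
    using is_succ_fin_ord[of 1] cnf_pred_fin_ord[of 1]
    by (simp add: fast_growing_succ numeral_2_eq_2 del: fin_ord_simps)
  have pow: "x \<le> 2 ^ x" using less_exp[of x] by simp
  have "x\<^sup>2 \<le> fast_growing (fin_ord 2) x"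
    using pow unfolding F2 power2_eq_square by simp
  also have "\<dots> \<le> fast_growing \<delta> x"
    using assms by (intro fast_growing_small) auto
  finally show ?thesis .
qed

text \<open>Ordinals \<open>\<beta> \<ge> \<omega>\<close> satisfy \<open>m + \<beta> = \<beta>\<close>; on the level of functions this costs a shift of the
  argument by \<open>m\<close>, which at \<open>\<beta> = \<omega>\<close> turns the index \<open>m + x\<close> into \<open>(\<omega>)_(x + m)\<close>.\<close>

lemma fast_rel_fin_absorb:
  assumes "omega \<le> \<beta>" "3 \<le> x"
  shows "fast_rel (fast_growing (fin_ord m)) \<beta> x + m \<le> fast_growing \<beta> (x + m)"
  using assms
proof (induction \<beta> arbitrary: x rule: cnf_cases_induct)
  case Zero
  then show ?case by (simp add: omega_def omega_pow_def less_eq_cnf_def)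
next
  case (succ \<beta>)
  interpret F: increasing "fast_growing (fin_ord m)" by (rule increasing_fast_growing)
  let ?G = "fast_rel (fast_growing (fin_ord m)) (cnf_pred \<beta>)"
  have "\<not> is_succ omega" by (simp add: omega_def omega_pow_def)
  then have "omega < \<beta>" using succ by (cases "omega = \<beta>") auto
  then have le: "omega \<le> cnf_pred \<beta>" using less_succ_imp_le_pred succ by blast
  \<comment> \<open>The summand \<open>m\<close> on the left carries the shift of the argument
    through each iteration; \<open>3 \<le>\<close> is kept for the induction hypothesis.\<close>
  have "3 \<le> (?G ^^ i) x \<and> (?G ^^ i) x + m \<le> (fast_growing (cnf_pred \<beta>) ^^ i) (x + m)" for i
  proof (induction i)
    case (Suc i)
    then have "?G ((?G ^^ i) x) + m \<le> fast_growing (cnf_pred \<beta>) ((?G ^^ i) x + m)"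
      using succ.IH le by blast
    also have "\<dots> \<le> fast_growing (cnf_pred \<beta>) ((fast_growing (cnf_pred \<beta>) ^^ i) (x + m))"
      using Suc fast_growing_mono by blast
    finally show ?case using Suc F.hardy_ge[of "(?G ^^ i) x"] by (auto intro: le_trans)
  qed (use succ.prems in simp)
  then have "(?G ^^ x) x + m \<le> (fast_growing (cnf_pred \<beta>) ^^ x) (x + m)" by blast
  also have "\<dots> \<le> (fast_growing (cnf_pred \<beta>) ^^ (x + m)) (x + m)"
    using fast_growing_ge by (intro funpow_increasing_le) auto
  finally show ?case using succ by (simp add: fast_rel_succ fast_growing_succ)
next
  case (limit \<beta>)
  show ?case
  proof (cases "\<beta> = omega")
    case True
    have omega_fund: "fund_seq omega y = fin_ord y" for y
      by (simp add: omega_def omega_pow_def fin_ord_def)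
    have "fast_rel (fast_growing (fin_ord m)) \<beta> x = fast_growing (fin_ord (m + x)) x"
      using limit True
      by (simp add: fast_rel_limit omega_fund fast_rel_fast_growing_fin_ord fin_ord_append)
    moreover have "fast_growing (fin_ord (m + x)) x + n \<le> fast_growing (fin_ord (m + x)) (x + n)" for n
    proof (induction n)
      case (Suc n)
      then show ?case
        using strict_monoD[OF increasing.strict_mono_h[OF increasing_fast_growing],
          of "x + n" "x + Suc n" "fin_ord (m + x)"] by simp
    qed simp
    moreover have "fast_growing \<beta> (x + m) = fast_growing (fin_ord (m + x)) (x + m)"
      using limit True
      by (simp add: fast_growing_eq_fast_rel fast_rel_limit omega_fund add.commute)
    ultimately show ?thesis by simp
  next
    case False
    \<comment> \<open>The threshold 3 comes from \<open>size omega = 2\<close>: it keeps the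
      \<open>x\<close>-th member above \<open>omega\<close>.\<close>
    have "is_cnf omega" "size omega < x" using limit by (auto simp: omega_def omega_pow_def)
    then have "omega < fund_seq \<beta> x"
      using less_fund_seq limit False by auto
    then have "fast_rel (fast_growing (fin_ord m)) \<beta> x + m \<le> fast_growing (fund_seq \<beta> x) (x + m)"
      using limit by (simp add: fast_rel_limit)
    also have "\<dots> \<le> fast_growing \<beta> (x + m)"
      unfolding fast_growing_eq_fast_rel using limit by (intro Suc.fast_rel_fund_seq_le) auto
    finally show ?thesis .
  qed
qed


section \<open>Natural sums of Cantor normal forms\<close>

primrec exps :: "cnf \<Rightarrow> cnf set" where
  "exps Zero = {}"
| "exps (OmegaPlus a b) = insert a (exps b)"

lemma is_cnf_OmegaPlus: "is_cnf (OmegaPlus a b) \<longleftrightarrow> is_cnf a \<and> is_cnf b \<and> (\<forall>c\<in>exps b. c \<le> a)"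
proof (induction b arbitrary: a)
  case (OmegaPlus c d)
  have "is_cnf (OmegaPlus a (OmegaPlus c d)) \<longleftrightarrow> is_cnf a \<and> is_cnf (OmegaPlus c d) \<and> c \<le> a"
    by auto
  then show ?case unfolding OmegaPlus.IH(2) by (auto intro: order_trans)
qed simp

lemma exps_cnf_append [simp]: "exps (cnf_append a b) = exps a \<union> exps b"
  by (induction a) auto

lemma size_cnf_append [simp]: "size (cnf_append a b) = size a + size b"
  by (induction a) auto

lemma is_cnf_append_one: "is_cnf a \<Longrightarrow> is_cnf (cnf_append a (omega_pow Zero))"
  by (induction a) (auto simp: is_cnf_OmegaPlus omega_pow_def simp del: is_cnf.simps(2))

text \<open>The left-hand term is the successor of \<open>s\<close>: a strict drop of the index
  leaves room for one application of \<open>h\<close>.\<close>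

lemma append_one_le_iff: "cnf_append s (omega_pow Zero) \<le> t \<longleftrightarrow> s < t"
proof (induction s arbitrary: t)
  case Zero
  then show ?case by (cases t) (auto simp: omega_pow_def Zero_neq_iff)
next
  case (OmegaPlus a b)
  then show ?case by (cases t) auto
qed

lemma nat_sum_Zero_right [simp]: "s \<oplus> Zero = s"
  by (cases s) auto

lemma exps_nat_sum [simp]: "exps (s \<oplus> t) = exps s \<union> exps t"
  by (induction s t rule: nat_sum.induct) auto

lemma size_nat_sum [simp]: "size (s \<oplus> t) = size s + size t"
  by (induction s t rule: nat_sum.induct) auto

lemma is_cnf_nat_sum: "is_cnf s \<Longrightarrow> is_cnf t \<Longrightarrow> is_cnf (s \<oplus> t)"
  by (induction s t rule: nat_sum.induct)
    (auto simp: is_cnf_OmegaPlus simp del: is_cnf.simps(2) intro: less_imp_le)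

lemma omega_pow_nat_sum [simp]:
  "omega_pow e \<oplus> OmegaPlus c d =
    (if e < c then OmegaPlus c (omega_pow e \<oplus> d) else OmegaPlus e (OmegaPlus c d))"
  by (simp add: omega_pow_def)

lemma exps_omega_pow [simp]: "exps (omega_pow e) = {e}"
  and size_omega_pow [simp]: "size (omega_pow e) = Suc (size e)"
  and is_cnf_omega_pow [simp]: "is_cnf (omega_pow e) = is_cnf e"
  by (auto simp: omega_pow_def)

lemma nat_sum_omega_pow_assoc: "(omega_pow e \<oplus> s) \<oplus> t = omega_pow e \<oplus> (s \<oplus> t)"
proof (induction s t rule: nat_sum.induct)
  case (3 a b c d)
  then show ?case by (auto split: if_splits)
next
  case (1 t)
  then show ?case by simp
qed simp

lemma nat_sum_omega_pow_mono: "s < t \<Longrightarrow> omega_pow e \<oplus> s < omega_pow e \<oplus> t"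
proof (induction s arbitrary: t)
  case Zero
  then show ?case by (cases t) (auto simp: omega_pow_def)
next
  case (OmegaPlus c d)
  then show ?case by (cases t) auto
qed

text \<open>Natural sums are taken one power at a time: associativity and monotonicity then reduce
  to a single power on the left.\<close>

definition insert_exps :: "cnf list \<Rightarrow> cnf \<Rightarrow> cnf" where
  "insert_exps es t = foldr (\<lambda>e u. omega_pow e \<oplus> u) es t"

lemma insert_exps_simps [simp]:
  "insert_exps [] t = t"
  "insert_exps (e # es) t = omega_pow e \<oplus> insert_exps es t"
  by (auto simp: insert_exps_def)

lemma insert_exps_append [simp]: "insert_exps (es @ es') t = insert_exps es (insert_exps es' t)"
  by (simp add: insert_exps_def)

lemma exps_insert_exps [simp]: "exps (insert_exps es t) = set es \<union> exps t"
  by (induction es) auto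

lemma size_insert_exps: "size (insert_exps es t) = (\<Sum>e\<leftarrow>es. Suc (size e)) + size t"
  by (induction es) auto

lemma is_cnf_insert_exps:
  "(\<And>e. e \<in> set es \<Longrightarrow> is_cnf e) \<Longrightarrow> is_cnf t \<Longrightarrow> is_cnf (insert_exps es t)"
  by (induction es) (auto intro!: is_cnf_nat_sum)

lemma insert_exps_nat_sum: "insert_exps es s \<oplus> t = insert_exps es (s \<oplus> t)"
  by (induction es) (auto simp: nat_sum_omega_pow_assoc)

lemma insert_exps_mono: "s < t \<Longrightarrow> insert_exps es s < insert_exps es t"
  by (induction es) (auto intro: nat_sum_omega_pow_mono)

lemma insert_exps_OmegaPlus:
  "(\<And>e. e \<in> set es \<Longrightarrow> e < c) \<Longrightarrow> insert_exps es (OmegaPlus c d) = OmegaPlus c (insert_exps es d)"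
  by (induction es) auto

lemma less_OmegaPlus: "(\<And>c. c \<in> exps s \<Longrightarrow> c < e) \<Longrightarrow> s < OmegaPlus e t"
  by (cases s) auto

text \<open>A power of \<omega> exceeds any finite natural sum of smaller powers, and a common
  summand preserves this: exponents of \<open>t\<close> not below \<open>e\<close> are peeled off
  both sides until only smaller ones remain. The inequality serves twice, for the exponents inside a
  monomial and for the monomials of a list.\<close>

lemma insert_exps_less:
  assumes "is_cnf t" "\<And>e'. e' \<in> set es \<Longrightarrow> e' < e"
  shows "insert_exps es t < omega_pow e \<oplus> t"
  using assms(1)
proof (induction t)
  case Zero
  have "insert_exps es Zero < OmegaPlus e Zero" using assms(2) by (intro less_OmegaPlus) auto
  then show ?case by (simp add: omega_pow_def)
next
  case (OmegaPlus c d)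
  have d: "is_cnf d" "\<forall>c'\<in>exps d. c' \<le> c"
    using OmegaPlus.prems by (auto simp: is_cnf_OmegaPlus simp del: is_cnf.simps)
  have IH: "insert_exps es d < omega_pow e \<oplus> d" using OmegaPlus.IH d by blast
  consider "e < c" | "e = c" | "c < e" by fastforce
  then show ?case
  proof cases
    case 1
    then have "insert_exps es (OmegaPlus c d) = OmegaPlus c (insert_exps es d)"
      using assms(2) by (intro insert_exps_OmegaPlus) (meson less_trans)
    with 1 IH show ?thesis by simp
  next
    case 2
    then have "insert_exps es (OmegaPlus c d) = OmegaPlus c (insert_exps es d)"
      using assms(2) by (intro insert_exps_OmegaPlus) auto
    moreover have "omega_pow e \<oplus> d = OmegaPlus e d"
      using d(2) 2 by (cases d) (auto simp: omega_pow_def)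
    ultimately show ?thesis using 2 IH by simp
  next
    case 3
    then have "insert_exps es (OmegaPlus c d) < OmegaPlus e (OmegaPlus c d)"
      using assms(2) d(2) by (intro less_OmegaPlus) auto
    with 3 show ?thesis by (auto dest: less_asym)
  qed
qed

section \<open>Residuals of products of word orderings\<close>

text \<open>A monomial is a list of alphabets \<open>[\<Delta>\<^sub>1, \<dots>, \<Delta>\<^sub>k]\<close>; it stands for the product of the orderings of
  words over \<open>\<Delta>\<^sub>i\<close> by embedding. A list of monomials stands for their disjoint sum. A set is represented
  by a monomial when it has an order-reflecting map into the product that does not increase norms.\<close>

definition represents :: "('a \<Rightarrow> 'a \<Rightarrow> bool) \<Rightarrow> ('a \<Rightarrow> nat) \<Rightarrow> 'a set \<Rightarrow> 'b set list \<Rightarrow> bool" where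
  "represents leq nm B m \<longleftrightarrow> (\<exists>\<phi>.
     (\<forall>x\<in>B. list_all2 (\<lambda>w \<Delta>. set w \<subseteq> \<Delta> \<and> length w \<le> nm x) (\<phi> x) m) \<and>
     (\<forall>x\<in>B. \<forall>y\<in>B. list_all2 subseq (\<phi> x) (\<phi> y) \<longrightarrow> leq x y))"

definition covers :: "('a \<Rightarrow> 'a \<Rightarrow> bool) \<Rightarrow> ('a \<Rightarrow> nat) \<Rightarrow> 'a set \<Rightarrow> 'b set list list \<Rightarrow> bool" where
  "covers leq nm S M \<longleftrightarrow> (\<exists>Bs. list_all2 (represents leq nm) Bs M \<and> S \<subseteq> \<Union>(set Bs))"

lemma covers_Nil [simp]: "covers leq nm S [] \<longleftrightarrow> S = {}"
  by (auto simp: covers_def)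

lemma covers_Cons:
  "covers leq nm S (m # M) \<longleftrightarrow> (\<exists>B. represents leq nm B m \<and> covers leq nm (S - B) M)"
proof
  assume "covers leq nm S (m # M)"
  then obtain B Bs where "represents leq nm B m" "list_all2 (represents leq nm) Bs M"
    "S \<subseteq> B \<union> \<Union>(set Bs)"
    by (auto simp: covers_def list_all2_Cons2)
  then show "\<exists>B. represents leq nm B m \<and> covers leq nm (S - B) M"
    unfolding covers_def by blast
next
  assume "\<exists>B. represents leq nm B m \<and> covers leq nm (S - B) M"
  then obtain B Bs where "represents leq nm B m" "list_all2 (represents leq nm) Bs M"
    "S - B \<subseteq> \<Union>(set Bs)"
    by (auto simp: covers_def)
  then have "list_all2 (represents leq nm) (B # Bs) (m # M)" "S \<subseteq> \<Union>(set (B # Bs))" by auto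
  then show "covers leq nm S (m # M)" unfolding covers_def by blast
qed

lemma covers_subset: "covers leq nm S M \<Longrightarrow> T \<subseteq> S \<Longrightarrow> covers leq nm T M"
  unfolding covers_def by blast

lemma covers_append:
  assumes "covers leq nm S M" "covers leq nm T N"
  shows "covers leq nm (S \<union> T) (M @ N)"
proof -
  obtain Bs Cs where "list_all2 (represents leq nm) Bs M" "S \<subseteq> \<Union>(set Bs)"
    "list_all2 (represents leq nm) Cs N" "T \<subseteq> \<Union>(set Cs)"
    using assms by (auto simp: covers_def)
  then have "list_all2 (represents leq nm) (Bs @ Cs) (M @ N)" "S \<union> T \<subseteq> \<Union>(set (Bs @ Cs))"
    by (auto intro: list_all2_appendI)
  then show ?thesis unfolding covers_def by blast
qed

lemma represents_vimage:
  assumes "represents leq nm B m"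
    and "\<And>x. x \<in> B' \<Longrightarrow> u x \<in> B \<and> nm (u x) \<le> nm' x"
    and "\<And>x y. x \<in> B' \<Longrightarrow> y \<in> B' \<Longrightarrow> leq (u x) (u y) \<Longrightarrow> leq' x y"
  shows "represents leq' nm' B' m"
proof -
  obtain \<phi> where \<phi>: "\<And>x. x \<in> B \<Longrightarrow> list_all2 (\<lambda>w \<Delta>. set w \<subseteq> \<Delta> \<and> length w \<le> nm x) (\<phi> x) m"
    "\<And>x y. x \<in> B \<Longrightarrow> y \<in> B \<Longrightarrow> list_all2 subseq (\<phi> x) (\<phi> y) \<Longrightarrow> leq x y"
    using assms(1) unfolding represents_def by blast
  have "list_all2 (\<lambda>w \<Delta>. set w \<subseteq> \<Delta> \<and> length w \<le> nm' x) (\<phi> (u x)) m" if "x \<in> B'" for x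
    using \<phi>(1)[of "u x"] assms(2)[OF that] by (auto elim: list_all2_mono)
  then show ?thesis
    unfolding represents_def using \<phi>(2) assms(2,3) by (intro exI[of _ "\<lambda>x. \<phi> (u x)"]) blast
qed

lemma covers_vimage:
  assumes "covers leq nm S M" "\<And>x. x \<in> S' \<Longrightarrow> u x \<in> S \<and> nm (u x) \<le> nm' x"
    and "\<And>x y. x \<in> S' \<Longrightarrow> y \<in> S' \<Longrightarrow> leq (u x) (u y) \<Longrightarrow> leq' x y"
  shows "covers leq' nm' S' M"
  using assms
proof (induction M arbitrary: S S')
  case Nil
  then show ?case by auto
next
  case (Cons m M)
  then obtain B where B: "represents leq nm B m" "covers leq nm (S - B) M"
    by (auto simp: covers_Cons)
  let ?B = "{x \<in> S'. u x \<in> B}"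
  have "represents leq' nm' ?B m"
    using Cons.prems by (intro represents_vimage[OF B(1), of _ u]) auto
  moreover have "covers leq' nm' (S' - ?B) M"
    using Cons.prems by (intro Cons.IH[OF B(2)]) auto
  ultimately show ?case by (auto simp: covers_Cons)
qed

text \<open>If \<open>w = a\<^sub>1\<dots>a\<^sub>k\<close> does not embed into \<open>v\<close>, then \<open>v = u\<^sub>1 a\<^sub>1 u\<^sub>2 a\<^sub>2 \<dots> u\<^sub>i\<close> with \<open>i \<le> k\<close> and
  \<open>a\<^sub>j\<close> not occurring in \<open>u\<^sub>j\<close>; \<open>split_off w v\<close> is \<open>[u\<^sub>1, \<dots>, u\<^sub>i]\<close>.\<close>

fun split_off :: "'b list \<Rightarrow> 'b list \<Rightarrow> 'b list list" where
  "split_off [] v = []"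
| "split_off (a # w) v =
     (if a \<in> set v then takeWhile (\<lambda>b. b \<noteq> a) v # split_off w (tl (dropWhile (\<lambda>b. b \<noteq> a) v)) else [v])"

lemma split_at_first:
  assumes "a \<in> set v"
  shows "v = takeWhile (\<lambda>b. b \<noteq> a) v @ a # tl (dropWhile (\<lambda>b. b \<noteq> a) v)"
  using assms by (induction v) auto

lemma subseq_Cons_if_subseq_tl:
  assumes "a \<in> set v" "subseq w (tl (dropWhile (\<lambda>b. b \<noteq> a) v))"
  shows "subseq (a # w) v"
  using assms by (subst split_at_first[OF assms(1)]) (auto intro: list_emb_append2)

lemma length_split_off: "\<not> subseq w v \<Longrightarrow> \<exists>i < length w. length (split_off w v) = Suc i"
proof (induction w arbitrary: v)
  case (Cons a w)
  then show ?case using subseq_Cons_if_subseq_tl[of a v w] by fastforce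
qed simp

lemma set_split_off:
  assumes "set v \<subseteq> \<Delta>" "length v \<le> k"
  shows "list_all2 (\<lambda>u \<Delta>. set u \<subseteq> \<Delta> \<and> length u \<le> k) (split_off w v)
    (map (\<lambda>a. \<Delta> - {a}) (take (length (split_off w v)) w))"
  using assms
proof (induction w arbitrary: v)
  case (Cons a w)
  show ?case
  proof (cases "a \<in> set v")
    case True
    let ?r = "tl (dropWhile (\<lambda>b. b \<noteq> a) v)"
    have v: "v = takeWhile (\<lambda>b. b \<noteq> a) v @ a # ?r" by (rule split_at_first[OF True])
    have "set v = set (takeWhile (\<lambda>b. b \<noteq> a) v) \<union> insert a (set ?r)"
      "length v = length (takeWhile (\<lambda>b. b \<noteq> a) v) + Suc (length ?r)"
      using arg_cong[OF v, of set] arg_cong[OF v, of length] by simp_all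
    then have "set ?r \<subseteq> \<Delta>" "length ?r \<le> k" "length (takeWhile (\<lambda>b. b \<noteq> a) v) \<le> k"
      using Cons.prems by simp_all
    moreover from this have "set (takeWhile (\<lambda>b. b \<noteq> a) v) \<subseteq> \<Delta> - {a}"
      using Cons.prems(1) set_takeWhileD by fastforce
    ultimately show ?thesis using True Cons.IH by simp
  next
    case False
    with Cons.prems show ?thesis by auto
  qed
qed simp

lemma subseq_if_split_off:
  assumes "\<not> subseq w v" "\<not> subseq w v'" "list_all2 subseq (split_off w v) (split_off w v')"
  shows "subseq v v'"
  using assms
proof (induction w arbitrary: v v')
  case (Cons a w)
  let ?u = "takeWhile (\<lambda>b. b \<noteq> a)" and ?r = "\<lambda>v. tl (dropWhile (\<lambda>b. b \<noteq> a) v)"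
  have tl: "\<not> subseq w (?r x)" if "x = v \<or> x = v'" "a \<in> set x" for x
    using subseq_Cons_if_subseq_tl[of a x w] that Cons.prems(1,2) by metis
  \<comment> \<open>A word containing \<open>a\<close> thus yields at least two factors and a word
    without \<open>a\<close> exactly one, so the mixed cases contradict equal lengths.\<close>
  have ne: "split_off w (?r x) \<noteq> []" if "x = v \<or> x = v'" "a \<in> set x" for x
    using length_split_off[OF tl[OF that]] by auto
  show ?case
  proof (cases "a \<in> set v \<and> a \<in> set v'")
    case True
    then have "list_all2 subseq (?u v # split_off w (?r v)) (?u v' # split_off w (?r v'))"
      using Cons.prems(3) by simp
    then have "subseq (?u v) (?u v')" "subseq (?r v) (?r v')"
      using Cons.IH[OF tl[of v] tl[of v']] True by simp_all
    then have "subseq (?u v @ a # ?r v) (?u v' @ a # ?r v')" by (simp add: list_emb_append_mono)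
    then show ?thesis
      unfolding split_at_first[OF conjunct1[OF True], symmetric] split_at_first[OF conjunct2[OF True], symmetric] .
  next
    case False
    consider "a \<in> set v" "a \<notin> set v'" | "a \<notin> set v" "a \<in> set v'" | "a \<notin> set v" "a \<notin> set v'"
      using False by blast
    then show ?thesis
    proof cases
      case 1
      with Cons.prems(3) ne[of v] show ?thesis by simp
    next
      case 2
      with Cons.prems(3) ne[of v'] show ?thesis by simp
    next
      case 3
      with Cons.prems(3) show ?thesis by simp
    qed
  qed
qed simp

text \<open>Here \<open>j\<close> is a coordinate at which the embedding fails, and
  \<open>i + 1\<close> is the number of factors that \<open>split_off\<close> produces
  there.\<close>

definition residual :: "'b set list \<Rightarrow> 'b list list \<Rightarrow> 'b set list list" where
  "residual m ws = map (\<lambda>(j, i). take j m @ map (\<lambda>a. m ! j - {a}) (take (Suc i) (ws ! j)) @ drop (Suc j) m)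
     (concat (map (\<lambda>j. map (\<lambda>i. (j, i)) [0..<length (ws ! j)]) [0..<length m]))"

lemma set_residual:
  "set (residual m ws) =
    {take j m @ map (\<lambda>a. m ! j - {a}) (take (Suc i) (ws ! j)) @ drop (Suc j) m |j i.
      j < length m \<and> i < length (ws ! j)}"
proof -
  have I: "set (concat (map (\<lambda>j. map (\<lambda>i. (j, i)) [0..<length (ws ! j)]) [0..<length m])) =
      {(j, i). j < length m \<and> i < length (ws ! j)}" by auto
  have "(\<lambda>(j, i). f j i) ` {(j, i). P j i} = {f j i |j i. P j i}"
    for f :: "nat \<Rightarrow> nat \<Rightarrow> 'b set list" and P
    by auto
  then show ?thesis unfolding residual_def set_map I .
qed

lemma length_residual:
  assumes "\<And>w. w \<in> set ws \<Longrightarrow> length w \<le> k" "length ws = length m"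
  shows "length (residual m ws) \<le> length m * k"
proof -
  have "length (residual m ws) = (\<Sum>j\<leftarrow>[0..<length m]. length (ws ! j))"
    by (simp add: residual_def length_concat comp_def)
  also have "\<dots> \<le> (\<Sum>j\<leftarrow>[0..<length m]. k)"
    using assms by (intro sum_list_mono) simp
  finally show ?thesis by (simp add: sum_list_triv)
qed

lemma represents_residual:
  assumes B: "represents leq nm B m" and x: "x \<in> B"
  shows "\<exists>ws. list_all2 (\<lambda>w \<Delta>. set w \<subseteq> \<Delta> \<and> length w \<le> nm x) ws m \<and>
    covers leq nm {y \<in> B. \<not> leq x y} (residual m ws)"
proof -
  obtain \<phi> where \<phi>: "\<And>x. x \<in> B \<Longrightarrow> list_all2 (\<lambda>w \<Delta>. set w \<subseteq> \<Delta> \<and> length w \<le> nm x) (\<phi> x) m"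
    "\<And>x y. x \<in> B \<Longrightarrow> y \<in> B \<Longrightarrow> list_all2 subseq (\<phi> x) (\<phi> y) \<Longrightarrow> leq x y"
    using B unfolding represents_def by blast
  define ws where "ws = \<phi> x"
  have len: "length (\<phi> y) = length m" if "y \<in> B" for y
    using \<phi>(1)[OF that] by (rule list_all2_lengthD)
  \<comment> \<open>Fixing the number of factors sends a whole block into one monomial. Blocks for
    different \<open>j\<close> may overlap, which a cover permits.\<close>
  define block where "block = (\<lambda>(j, i). {y \<in> B. \<not> subseq (ws ! j) (\<phi> y ! j) \<and>
    length (split_off (ws ! j) (\<phi> y ! j)) = Suc i})"
  let ?I = "concat (map (\<lambda>j. map (\<lambda>i. (j, i)) [0..<length (ws ! j)]) [0..<length m])"
  have "represents leq nm (block (j, i))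
      (take j m @ map (\<lambda>a. m ! j - {a}) (take (Suc i) (ws ! j)) @ drop (Suc j) m)" (is "represents _ _ _ ?m")
    if j: "j < length m" for j i
  proof -
    let ?\<psi> = "\<lambda>y. take j (\<phi> y) @ split_off (ws ! j) (\<phi> y ! j) @ drop (Suc j) (\<phi> y)"
    have "list_all2 (\<lambda>w \<Delta>. set w \<subseteq> \<Delta> \<and> length w \<le> nm y) (?\<psi> y) ?m" if y: "y \<in> block (j, i)" for y
    proof -
      have yB: "y \<in> B" and sl: "length (split_off (ws ! j) (\<phi> y ! j)) = Suc i"
        using y by (auto simp: block_def)
      have "set (\<phi> y ! j) \<subseteq> m ! j" "length (\<phi> y ! j) \<le> nm y"
        using list_all2_nthD2[OF \<phi>(1)[OF yB] j] by auto
      from set_split_off[OF this, of "ws ! j"] show ?thesis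
        unfolding sl using \<phi>(1)[OF yB]
        by (intro list_all2_appendI list_all2_takeI list_all2_dropI)
    qed
    moreover have "leq y z"
      if y: "y \<in> block (j, i)" and z: "z \<in> block (j, i)" and "list_all2 subseq (?\<psi> y) (?\<psi> z)" for y z
    proof -
      have yz: "y \<in> B" "z \<in> B" using y z by (auto simp: block_def)
      have "length (split_off (ws ! j) (\<phi> y ! j)) = length (split_off (ws ! j) (\<phi> z ! j))"
        using y z by (auto simp: block_def)
      then have parts: "list_all2 subseq (take j (\<phi> y)) (take j (\<phi> z))"
        "list_all2 subseq (split_off (ws ! j) (\<phi> y ! j)) (split_off (ws ! j) (\<phi> z ! j))"
        "list_all2 subseq (drop (Suc j) (\<phi> y)) (drop (Suc j) (\<phi> z))"
        using that(3) len yz by (auto simp: list_all2_append)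
      have "subseq (\<phi> y ! j) (\<phi> z ! j)"
        using subseq_if_split_off parts(2) y z by (auto simp: block_def)
      with parts have "list_all2 subseq (take j (\<phi> y) @ \<phi> y ! j # drop (Suc j) (\<phi> y))
          (take j (\<phi> z) @ \<phi> z ! j # drop (Suc j) (\<phi> z))"
        by (intro list_all2_appendI) auto
      then have "list_all2 subseq (\<phi> y) (\<phi> z)"
        using j len yz by (simp add: id_take_nth_drop[symmetric])
      then show ?thesis using \<phi>(2) yz by blast
    qed
    ultimately show ?thesis
      unfolding represents_def by (intro exI[of _ ?\<psi>]) blast
  qed
  then have "list_all2 (represents leq nm) (map block ?I) (residual m ws)"
    unfolding residual_def list_all2_map1 list_all2_map2 list_all2_same by auto
  moreover have "{y \<in> B. \<not> leq x y} \<subseteq> \<Union>(set (map block ?I))"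
  proof
    fix y assume "y \<in> {y \<in> B. \<not> leq x y}"
    then have y: "y \<in> B" "\<not> list_all2 subseq ws (\<phi> y)" using \<phi>(2) x by (auto simp: ws_def)
    then obtain j where j: "j < length m" "\<not> subseq (ws ! j) (\<phi> y ! j)"
      using len x by (auto simp: list_all2_conv_all_nth ws_def)
    then obtain i where "i < length (ws ! j)" "length (split_off (ws ! j) (\<phi> y ! j)) = Suc i"
      using length_split_off by blast
    with j y show "y \<in> \<Union>(set (map block ?I))"
      by (auto simp: block_def intro!: bexI[of _ "(j, i)"])
  qed
  ultimately have "covers leq nm {y \<in> B. \<not> leq x y} (residual m ws)"
    unfolding covers_def by blast
  with \<phi>(1)[OF x] show ?thesis unfolding ws_def by blast
qed

lemma covers_residual:
  assumes "covers leq nm S M" "x \<in> S"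
  shows "\<exists>M1 m M2 ws. M = M1 @ m # M2 \<and>
    list_all2 (\<lambda>w \<Delta>. set w \<subseteq> \<Delta> \<and> length w \<le> nm x) ws m \<and>
    covers leq nm {y \<in> S. \<not> leq x y} (M1 @ residual m ws @ M2)"
proof -
  obtain Bs where Bs: "list_all2 (represents leq nm) Bs M" "S \<subseteq> \<Union>(set Bs)"
    using assms by (auto simp: covers_def)
  then obtain B where B: "B \<in> set Bs" "x \<in> B" using assms(2) by blast
  then obtain Bs1 Bs2 where split: "Bs = Bs1 @ B # Bs2" by (auto dest: split_list)
  with Bs obtain M1 m M2 where M: "M = M1 @ m # M2" "list_all2 (represents leq nm) Bs1 M1"
    "represents leq nm B m" "list_all2 (represents leq nm) Bs2 M2"
    by (auto simp: list_all2_append1 list_all2_Cons1)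
  obtain ws where ws: "list_all2 (\<lambda>w \<Delta>. set w \<subseteq> \<Delta> \<and> length w \<le> nm x) ws m"
    "covers leq nm {y \<in> B. \<not> leq x y} (residual m ws)"
    using represents_residual[OF M(3) B(2)] by blast
  have "covers leq nm (\<Union>(set Bs1)) M1" "covers leq nm (\<Union>(set Bs2)) M2"
    using M by (auto simp: covers_def)
  then have "covers leq nm (\<Union>(set Bs1) \<union> ({y \<in> B. \<not> leq x y} \<union> \<Union>(set Bs2))) (M1 @ residual m ws @ M2)"
    using ws(2) by (intro covers_append)
  then have "covers leq nm {y \<in> S. \<not> leq x y} (M1 @ residual m ws @ M2)"
    by (rule covers_subset) (use Bs(2) split in auto)
  with M ws show ?thesis by blast
qed


subsection \<open>Order types of lists of monomials\<close>

text \<open>Words over \<open>\<Delta>\<close> have the maximal order type \<open>\<omega>\<^bsup>\<omega>\<^bsup>|\<Delta>| - 1\<^esup>\<^esup>\<close> if \<open>\<Delta>\<close> is nonempty and \<open>1 = \<omega>\<^bsup>0\<^esup>\<close>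
  otherwise; so \<open>mon_exp m\<close> is the exponent of \<open>\<omega>\<close> in the order type of the monomial \<open>m\<close>.\<close>

definition alph_exps :: "'b set \<Rightarrow> cnf list" where
  "alph_exps \<Delta> = (if \<Delta> = {} then [] else [fin_ord (card \<Delta> - 1)])"

definition mon_exp :: "'b set list \<Rightarrow> cnf" where
  "mon_exp m = insert_exps (concat (map alph_exps m)) Zero"

definition mons_ord :: "'b set list list \<Rightarrow> cnf" where
  "mons_ord M = insert_exps (map mon_exp M) Zero"

lemma is_cnf_alph_exps: "e \<in> set (concat (map alph_exps m)) \<Longrightarrow> is_cnf e"
  by (auto simp: alph_exps_def split: if_splits)

lemma is_cnf_mon_exp [simp]: "is_cnf (mon_exp m)"
  unfolding mon_exp_def by (rule is_cnf_insert_exps[OF is_cnf_alph_exps]) auto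

lemma is_cnf_mons_ord [simp]: "is_cnf (mons_ord M)"
  unfolding mons_ord_def by (rule is_cnf_insert_exps) auto

lemma mon_exp_append: "mon_exp (m @ m') = mon_exp m \<oplus> mon_exp m'"
  by (simp add: mon_exp_def insert_exps_nat_sum)

lemma exps_mons_ord: "exps (mons_ord M) = mon_exp ` set M"
  by (simp add: mons_ord_def)

text \<open>One exponent is traded for finitely many smaller ones, so
  \<open>insert_exps_less\<close> applies inside the exponent.\<close>

lemma mon_exp_residual_less:
  assumes "list_all2 (\<lambda>w \<Delta>. set w \<subseteq> \<Delta>) ws m" "\<And>\<Delta>. \<Delta> \<in> set m \<Longrightarrow> finite \<Delta>"
    and "m' \<in> set (residual m ws)"
  shows "mon_exp m' < mon_exp m"
proof -
  obtain j i where ji: "j < length m" "i < length (ws ! j)"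
    and m': "m' = take j m @ map (\<lambda>a. m ! j - {a}) (take (Suc i) (ws ! j)) @ drop (Suc j) m"
    using assms(3) by (auto simp: set_residual)
  let ?\<Delta> = "m ! j"
  have sub: "set (ws ! j) \<subseteq> ?\<Delta>" using list_all2_nthD2[OF assms(1) ji(1)] .
  have fin: "finite ?\<Delta>" using assms(2) ji by simp
  have ne: "?\<Delta> \<noteq> {}" using sub ji by fastforce
  let ?t = "insert_exps (concat (map alph_exps (drop (Suc j) m))) Zero"
  let ?new = "concat (map alph_exps (map (\<lambda>a. ?\<Delta> - {a}) (take (Suc i) (ws ! j))))"
  \<comment> \<open>An alphabet that becomes empty contributes no exponent, so only alphabets that
    keep a letter are compared.\<close>
  have "e' < fin_ord (card ?\<Delta> - 1)" if new: "e' \<in> set ?new" for e'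
  proof -
    obtain a where "a \<in> set (take (Suc i) (ws ! j))" "e' \<in> set (alph_exps (?\<Delta> - {a}))"
      using new unfolding set_concat set_map by blast
    then have a: "a \<in> ?\<Delta>" "?\<Delta> - {a} \<noteq> {}" "e' = fin_ord (card (?\<Delta> - {a}) - 1)"
      using sub in_set_takeD[of a "Suc i" "ws ! j"]
      by (auto simp: alph_exps_def simp del: card_Diff_singleton card_Diff_insert split: if_splits)
    have "0 < card (?\<Delta> - {a})" using a(2) fin by (simp only: card_gt_0_iff finite_Diff simp_thms)
    then show ?thesis unfolding a(3) using card_Diff_singleton[OF a(1)] by simp
  qed
  moreover have "is_cnf ?t" by (rule is_cnf_insert_exps[OF is_cnf_alph_exps]) auto
  ultimately have "insert_exps ?new ?t < omega_pow (fin_ord (card ?\<Delta> - 1)) \<oplus> ?t"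
    by (intro insert_exps_less)
  also have "\<dots> = insert_exps (alph_exps ?\<Delta>) ?t" using ne by (simp add: alph_exps_def)
  finally have "insert_exps (concat (map alph_exps (take j m))) (insert_exps ?new ?t) <
      insert_exps (concat (map alph_exps (take j m))) (insert_exps (alph_exps ?\<Delta>) ?t)"
    by (rule insert_exps_mono)
  also have "\<dots> = mon_exp (take j m @ ?\<Delta> # drop (Suc j) m)" by (simp add: mon_exp_def)
  also have "\<dots> = mon_exp m" using ji(1) by (simp add: id_take_nth_drop[symmetric])
  finally show ?thesis by (simp add: m' mon_exp_def)
qed

text \<open>The same trade one level up: one monomial for several with smaller exponents.\<close>

lemma mons_ord_residual_less:
  assumes "list_all2 (\<lambda>w \<Delta>. set w \<subseteq> \<Delta>) ws m" "\<And>\<Delta>. \<Delta> \<in> set m \<Longrightarrow> finite \<Delta>"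
  shows "mons_ord (M1 @ residual m ws @ M2) < mons_ord (M1 @ m # M2)"
proof -
  have "insert_exps (map mon_exp (residual m ws)) (mons_ord M2) < omega_pow (mon_exp m) \<oplus> mons_ord M2"
    using mon_exp_residual_less[OF assms] by (intro insert_exps_less) auto
  then show ?thesis by (simp add: mons_ord_def insert_exps_mono)
qed

section \<open>Polynomial size bounds for lists of monomials\<close>

definition bounded_mons :: "nat \<Rightarrow> 'b set list list \<Rightarrow> bool" where
  "bounded_mons s M \<longleftrightarrow> length M \<le> s \<and>
     (\<forall>m\<in>set M. length m \<le> s \<and> (\<forall>\<Delta>\<in>set m. finite \<Delta> \<and> card \<Delta> \<le> s))"

lemma bounded_mons_mono: "bounded_mons s M \<Longrightarrow> s \<le> t \<Longrightarrow> bounded_mons t M"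
  unfolding bounded_mons_def by (meson le_trans)

lemma bounded_mons_exists:
  assumes "\<And>m \<Delta>. m \<in> set M \<Longrightarrow> \<Delta> \<in> set m \<Longrightarrow> finite \<Delta>"
  shows "\<exists>s. bounded_mons s M"
proof -
  define t where "t m = length m + sum_list (map card m)" for m :: "'a set list"
  let ?s = "length M + sum_list (map t M)"
  have "t m \<le> ?s" if "m \<in> set M" for m
    using that member_le_sum_list[of "t m" "map t M"] by simp
  moreover have "length m \<le> t m" "\<Delta> \<in> set m \<Longrightarrow> card \<Delta> \<le> t m" for m \<Delta>
    using member_le_sum_list[of "card \<Delta>" "map card m"] by (auto simp: t_def)
  ultimately have "bounded_mons ?s M"
    unfolding bounded_mons_def using assms by (meson le_add1 le_trans)
  then show ?thesis ..
qed

text \<open>At most \<open>s * s\<close> new monomials join at most \<open>s\<close> old ones; a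
  monomial grows to length at most \<open>s + s\<close>, and alphabets only shrink.\<close>

lemma bounded_mons_residual:
  assumes "bounded_mons s (M1 @ m # M2)" "length ws = length m" "\<And>w. w \<in> set ws \<Longrightarrow> length w \<le> s"
  shows "bounded_mons ((s + 1)\<^sup>2) (M1 @ residual m ws @ M2)"
proof -
  have len: "length m \<le> s" "length M1 + length M2 \<le> s" using assms(1) by (auto simp: bounded_mons_def)
  have sq: "(s + 1)\<^sup>2 = s * s + s + s + 1" by (simp add: power2_eq_square)
  have "length (residual m ws) \<le> s * s"
    using length_residual[OF assms(3,2)] len(1) by (meson le_trans mult_le_mono1)
  with len have "length (M1 @ residual m ws @ M2) \<le> (s + 1)\<^sup>2" unfolding sq by simp
  moreover have "length m' \<le> (s + 1)\<^sup>2 \<and> (\<forall>\<Delta>\<in>set m'. finite \<Delta> \<and> card \<Delta> \<le> (s + 1)\<^sup>2)"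
    if new: "m' \<in> set (residual m ws)" for m'
  proof -
    obtain j i where ji: "j < length m" "i < length (ws ! j)"
      and m': "m' = take j m @ map (\<lambda>a. m ! j - {a}) (take (Suc i) (ws ! j)) @ drop (Suc j) m"
      using new by (auto simp: set_residual)
    have "length (ws ! j) \<le> s" using assms ji by simp
    with ji len have "length m' \<le> s + s" by (simp add: m')
    moreover have "finite \<Delta> \<and> card \<Delta> \<le> s" if \<Delta>: "\<Delta> \<in> set m" for \<Delta>
      using assms(1) \<Delta> by (auto simp: bounded_mons_def)
    then have "finite \<Delta> \<and> card \<Delta> \<le> s" if "\<Delta> \<in> set m'" for \<Delta>
    proof -
      have "\<Delta> \<in> set m \<or> (\<exists>a. \<Delta> = m ! j - {a})"
        using that by (auto simp: m' dest: in_set_takeD in_set_dropD)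
      then have "\<exists>\<Delta>'\<in>set m. \<Delta> \<subseteq> \<Delta>'"
        using nth_mem[OF ji(1)] by (metis Diff_subset order_refl)
      then show ?thesis using \<open>\<And>\<Delta>. \<Delta> \<in> set m \<Longrightarrow> finite \<Delta> \<and> card \<Delta> \<le> s\<close>
        by (meson card_mono finite_subset le_trans)
    qed
    ultimately show ?thesis unfolding sq by fastforce
  qed
  moreover have "bounded_mons ((s + 1)\<^sup>2) (M1 @ m # M2)"
    using assms(1) by (rule bounded_mons_mono) (unfold sq, simp)
  ultimately show ?thesis by (auto simp: bounded_mons_def)
qed

lemma size_mons_ord:
  assumes "bounded_mons s M"
  shows "size (mons_ord M) \<le> s * (s * s + 1)"
proof -
  have "size (mon_exp m) \<le> s * s" if "m \<in> set M" for m
  proof -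
    have "size (mon_exp m) = (\<Sum>\<Delta>\<leftarrow>m. \<Sum>e\<leftarrow>alph_exps \<Delta>. Suc (size e))"
      unfolding mon_exp_def by (induction m) (simp_all add: size_insert_exps)
    also have "\<dots> \<le> (\<Sum>\<Delta>\<leftarrow>m. s)"
    proof (rule sum_list_mono)
      fix \<Delta> assume "\<Delta> \<in> set m"
      then have "finite \<Delta>" "card \<Delta> \<le> s" using assms that by (auto simp: bounded_mons_def)
      then show "(\<Sum>e\<leftarrow>alph_exps \<Delta>. Suc (size e)) \<le> s"
        by (auto simp: alph_exps_def card_gt_0_iff Suc_diff_1)
    qed
    also have "\<dots> = length m * s" by (simp add: sum_list_triv)
    also have "\<dots> \<le> s * s" using assms that by (simp add: bounded_mons_def)
    finally show ?thesis .
  qed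
  then have "(\<Sum>m\<leftarrow>M. Suc (size (mon_exp m))) \<le> (\<Sum>m\<leftarrow>M. s * s + 1)"
    by (intro sum_list_mono) simp
  also have "\<dots> \<le> s * (s * s + 1)"
    using assms mult_le_mono1[of "length M" s "s * s + 1"] by (simp add: sum_list_triv bounded_mons_def)
  finally show ?thesis by (simp add: mons_ord_def size_insert_exps comp_def)
qed

section \<open>Lengths of controlled bad sequences\<close>

lemma bad_ConsD: "bad A (x # xs) \<Longrightarrow> bad A xs \<and> (\<forall>y\<in>set xs. \<not> le A x y)"
proof
  assume bad: "bad A (x # xs)"
  show "bad A xs"
    unfolding bad_def
  proof
    assume "\<exists>i j. i < j \<and> j < length xs \<and> le A (xs ! i) (xs ! j)"
    then obtain i j where "i < j" "j < length xs" "le A (xs ! i) (xs ! j)" by blast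
    then have "Suc i < Suc j" "Suc j < length (x # xs)" "le A ((x # xs) ! Suc i) ((x # xs) ! Suc j)"
      by auto
    then show False using bad unfolding bad_def by blast
  qed
  show "\<forall>y\<in>set xs. \<not> le A x y"
  proof
    fix y assume "y \<in> set xs"
    then obtain j where "j < length xs" "xs ! j = y" by (auto simp: in_set_conv_nth)
    then have "0 < Suc j" "Suc j < length (x # xs)" "(x # xs) ! 0 = x" "(x # xs) ! Suc j = y" by auto
    then show "\<not> le A x y" using bad unfolding bad_def by metis
  qed
qed

lemma controlled_ConsD: "controlled A g n (x # xs) \<Longrightarrow> qnorm A x < n \<and> controlled A g (g n) xs"
  unfolding controlled_def by (auto simp: funpow_swap1 dest: spec[of _ 0] spec[of _ "Suc _"])

text \<open>The argument \<open>y\<close> dominates a bound \<open>s\<close> on the monomials so generously that the order type of the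
  residual, a term of size polynomial in \<open>s\<close>, is reached from that of \<open>M\<close> by pointwise descent at \<open>y\<close>.\<close>

lemma (in increasing) length_add_le_hardy:
  assumes g: "mono g" and h: "\<And>y. y0 \<le> y \<Longrightarrow> ((y + 1)\<^sup>2 + g y + 2) ^ 8 \<le> h y"
    and "covers (le A) (qnorm A) S M" "bounded_mons s M" "n \<le> s" "(s + 2) ^ 8 \<le> y" "y0 \<le> y"
    and "set xs \<subseteq> S" "controlled A g n xs" "bad A xs"
  shows "length xs + y \<le> hardy h (mons_ord M) y"
  using assms(3-)
proof (induction xs arbitrary: S M s n y)
  case Nil
  then show ?case by (simp add: hardy_ge)
next
  case (Cons x xs)
  have xs: "bad A xs" "\<forall>y\<in>set xs. \<not> le A x y" "qnorm A x < n" "controlled A g (g n) xs"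
    using bad_ConsD[OF Cons.prems(8)] controlled_ConsD[OF Cons.prems(7)] by simp_all
  have "x \<in> S" using Cons.prems(6) by simp
  then obtain M1 m M2 ws where M: "M = M1 @ m # M2"
    and ws: "list_all2 (\<lambda>w \<Delta>. set w \<subseteq> \<Delta> \<and> length w \<le> qnorm A x) ws m"
    and cov: "covers (le A) (qnorm A) {y \<in> S. \<not> le A x y} (M1 @ residual m ws @ M2)"
    using covers_residual[OF Cons.prems(1)] by blast
  let ?M = "M1 @ residual m ws @ M2" and ?s = "(s + 1)\<^sup>2"
  have "length w \<le> s" if "w \<in> set ws" for w
  proof -
    have "length w \<le> qnorm A x"
      using ws that by (auto simp: list_all2_conv_all_nth in_set_conv_nth)
    then show ?thesis using xs(3) Cons.prems(3) by simp
  qed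
  then have bd: "bounded_mons ?s ?M"
    using Cons.prems(2) ws M by (intro bounded_mons_residual) (auto dest: list_all2_lengthD)
  have less: "mons_ord ?M < mons_ord M"
    unfolding M
  proof (rule mons_ord_residual_less)
    show "list_all2 (\<lambda>w \<Delta>. set w \<subseteq> \<Delta>) ws m" using ws by (rule list_all2_mono) simp
    show "finite \<Delta>" if "\<Delta> \<in> set m" for \<Delta>
      using that Cons.prems(2) M by (auto simp: bounded_mons_def)
  qed
  have sy: "s \<le> y"
  proof -
    have "s + 2 \<le> (s + 2) ^ 8" by (rule self_le_power) auto
    then show ?thesis using Cons.prems(4) by linarith
  qed
  \<comment> \<open>The left side, with 1 for the successor, is below the sixth power of
    \<open>s + 2\<close>; the exponent 8 is chosen because three squarings reach it.\<close>
  have size_less: "size (mons_ord ?M) + 1 < y"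
  proof -
    let ?t = "?s + 1"
    have "size (mons_ord ?M) + 1 \<le> ?s * (?s * ?s + 1) + 1"
      using size_mons_ord[OF bd] by simp
    also have "\<dots> < ?t ^ 3"
    proof -
      have "0 < ?s" by simp
      then show ?thesis unfolding power3_eq_cube by (simp add: algebra_simps del: power_eq_0_iff zero_less_power)
    qed
    also have "\<dots> \<le> ((s + 2)\<^sup>2) ^ 3"
      by (intro power_mono) (simp_all add: power2_eq_square)
    also have "\<dots> \<le> (s + 2) ^ 8"
      unfolding power_mult[symmetric] by (intro power_increasing) auto
    also have "\<dots> \<le> y" by (rule Cons.prems(4))
    finally show ?thesis .
  qed
  let ?o = "cnf_append (mons_ord ?M) (omega_pow Zero)"
  have "(?s + g s + 2) ^ 8 \<le> ((y + 1)\<^sup>2 + g y + 2) ^ 8"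
    using sy monoD[OF g sy] by (intro power_mono add_mono) auto
  also have "\<dots> \<le> h y" by (rule h[OF Cons.prems(5)])
  finally have hy: "(?s + g s + 2) ^ 8 \<le> h y" .
  have "1 \<le> y" using size_less by simp
  then have "y < h y" by (rule greater_h)
  \<comment> \<open>The induction continues with \<open>?s + g s\<close> in place of
    \<open>s\<close>: it bounds the new monomials as well as the control value \<open>g n\<close>,
    and \<open>hy\<close> makes \<open>h y\<close> large enough for it.\<close>
  have "length xs + h y \<le> hardy h (mons_ord ?M) (h y)"
  proof (rule Cons.IH[OF cov _ _ hy])
    show "bounded_mons (?s + g s) ?M" using bd by (rule bounded_mons_mono) simp
    show "g n \<le> ?s + g s" using monoD[OF g Cons.prems(3)] by simp
    show "y0 \<le> h y" using Cons.prems(5) \<open>y < h y\<close> by simp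
    show "set xs \<subseteq> {y \<in> S. \<not> le A x y}" using Cons.prems(6) xs(2) by auto
  qed (use xs in auto)
  \<comment> \<open>The call of \<open>h\<close> is charged to the successor of the residual order
    type, which is still at most that of \<open>M\<close>.\<close>
  also have "\<dots> = hardy h ?o y" by (simp add: hardy_append fast_rel_Zero)
  also have "\<dots> \<le> hardy h (mons_ord M) y"
    using less size_less by (intro hardy_small is_cnf_append_one) (auto simp: append_one_le_iff)
  \<comment> \<open>\<open>y < h y\<close> pays for the removed element; this is why
    \<open>y\<close> is added to the length in the claim.\<close>
  finally show ?case using \<open>y < h y\<close> by simp
qed

text \<open>The bound on individual lengths also makes the set of lengths finite, so
  \<open>Max\<close> is a genuine maximum.\<close>

lemma length_fun_le:
  assumes "\<And>xs. set xs \<subseteq> carrier A \<Longrightarrow> controlled A g n xs \<Longrightarrow> bad A xs \<Longrightarrow> length xs \<le> b"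
  shows "length_fun A g n \<le> b"
proof -
  let ?L = "{length xs |xs. set xs \<subseteq> carrier A \<and> controlled A g n xs \<and> bad A xs}"
  have sub: "?L \<subseteq> {..b}" using assms by auto
  have "length [] \<in> ?L" by (intro CollectI exI[of _ "[]"]) (auto simp: controlled_def bad_def)
  then have "?L \<noteq> {}" by blast
  moreover have "finite ?L" using sub finite_subset by blast
  ultimately show ?thesis unfolding length_fun_def using sub by (subst Max_le_iff) auto
qed

lemma pow8_le_fast_growing:
  assumes "fin_ord 2 \<le> \<delta>" "4 \<le> x"
  shows "x ^ 8 \<le> (fast_growing \<delta> ^^ 3) x"
proof -
  let ?F = "fast_growing \<delta>"
  have ge: "4 \<le> (?F ^^ i) x" for i
    using funpow_increasing[of ?F x i, OF fast_growing_ge] assms(2) by simp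
  have sq: "((?F ^^ i) x)\<^sup>2 \<le> ?F ((?F ^^ i) x)" for i
    by (rule fast_growing_ge_square[OF assms(1) ge])
  have "x ^ 8 = ((x\<^sup>2)\<^sup>2)\<^sup>2" by (simp add: power_mult[symmetric])
  also have "\<dots> \<le> ((?F x)\<^sup>2)\<^sup>2" using sq[of 0] by (intro power_mono) auto
  also have "\<dots> \<le> (?F (?F x))\<^sup>2" using sq[of 1] by (intro power_mono) auto
  also have "\<dots> \<le> ?F (?F (?F x))" using sq[of 2] by (simp add: numeral_2_eq_2)
  finally show ?thesis by (simp add: numeral_3_eq_3)
qed

text \<open>All exponents are at most \<open>\<beta>\<close>, so the order type lies below a finite
  multiple of one power, and a finite multiple means finitely many iterates.\<close>

lemma length_fun_bound:
  assumes g: "smooth g" and \<delta>: "fin_ord 2 \<le> \<delta>"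
    and gF: "\<And>x. x0 \<le> x \<Longrightarrow> g x \<le> (fast_growing \<delta> ^^ c) x"
    and cov: "covers (le A) (qnorm A) (carrier A) M" and bd: "bounded_mons s M"
    and \<beta>: "\<And>m. m \<in> set M \<Longrightarrow> mon_exp m \<le> \<beta>"
  shows "\<exists>C k. 4 \<le> C \<and> (\<forall>n. length_fun A g n \<le> (fast_rel (fast_growing \<delta>) \<beta> ^^ k) ((n + C) ^ 8))"
proof -
  interpret F: increasing "fast_growing \<delta>" by (rule increasing_fast_growing)
  let ?F = "fast_growing \<delta>" and ?c = "c + 6"
  interpret h: increasing "?F ^^ ?c" by (rule F.increasing_funpow) simp
  have "g x \<le> g (Suc x)" for x using g by (simp add: smooth_def Suc_leD)
  then have g_mono: "mono g" by (rule mono_iff_le_Suc[THEN iffD2, rule_format])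
  \<comment> \<open>The six extra iterates: two for \<open>(y + 1)\<^sup>2 + 2\<close>, one for
    adding \<open>g y\<close>, three for the eighth power.\<close>
  have h: "((y + 1)\<^sup>2 + g y + 2) ^ 8 \<le> (?F ^^ ?c) y" if y: "x0 + 4 \<le> y" for y
  proof -
    let ?Z = "(?F ^^ (c + 2)) y"
    have incr: "i \<le> j \<Longrightarrow> (?F ^^ i) y \<le> (?F ^^ j) y" for i j
      using fast_growing_ge by (intro funpow_increasing_le)
    have Z4: "4 \<le> ?Z" using incr[of 0 "c + 2"] y by simp
    have Fy: "y\<^sup>2 \<le> ?F y" using fast_growing_ge_square[OF \<delta>] y by simp
    have FFy: "(?F y)\<^sup>2 \<le> ?F (?F y)"
      using fast_growing_ge_square[OF \<delta>] fast_growing_ge[of y \<delta>] y by simp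
    have "(y + 1)\<^sup>2 + 2 \<le> (2 * y)\<^sup>2"
    proof -
      have "(y + 1)\<^sup>2 + 2 = y * y + (2 * y + 3)" by (simp add: power2_eq_square)
      also have "2 * y + 3 \<le> 3 * y" using y by simp
      also have "3 * y \<le> 3 * (y * y)" by simp
      finally show ?thesis by (simp add: power2_eq_square)
    qed
    also have "\<dots> \<le> (y\<^sup>2)\<^sup>2"
      using y by (intro power_mono) (auto simp: power2_eq_square)
    also have "\<dots> \<le> (?F y)\<^sup>2" using Fy by (intro power_mono) auto
    also have "\<dots> \<le> (?F ^^ 2) y" using FFy by (simp add: numeral_2_eq_2)
    also have "\<dots> \<le> ?Z" by (rule incr) simp
    finally have "(y + 1)\<^sup>2 + 2 \<le> ?Z" .
    moreover have "g y \<le> ?Z" using gF[of y] incr[of c "c + 2"] y by simp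
    ultimately have "(y + 1)\<^sup>2 + g y + 2 \<le> 2 * ?Z" by simp
    also have "\<dots> \<le> ?Z\<^sup>2" using Z4 by (simp add: power2_eq_square)
    also have "\<dots> \<le> ?F ?Z" by (rule fast_growing_ge_square[OF \<delta> Z4])
    finally have "((y + 1)\<^sup>2 + g y + 2) ^ 8 \<le> (?F ?Z) ^ 8" by (rule power_mono) simp
    also have "\<dots> \<le> (?F ^^ 3) (?F ?Z)"
      using Z4 fast_growing_ge[of ?Z \<delta>] by (intro pow8_le_fast_growing[OF \<delta>]) simp
    also have "\<dots> = (?F ^^ (3 + (Suc (c + 2)))) y" by (simp only: funpow_add comp_apply funpow.simps)
    also have "3 + (Suc (c + 2)) = ?c" by simp
    finally show ?thesis .
  qed
  \<comment> \<open>Exceeds the number of summands of the order type, which \<open>size\<close>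
    bounds.\<close>
  define N where "N = Suc (size (mons_ord M))"
  define C where "C = s + x0 + N + 4"
  have "length_fun A g n \<le> (fast_rel ?F \<beta> ^^ (?c * N)) ((n + C) ^ 8)" for n
  proof (rule length_fun_le)
    fix xs assume xs: "set xs \<subseteq> carrier A" "controlled A g n xs" "bad A xs"
    let ?y = "(n + C) ^ 8"
    have y: "n + C \<le> ?y" by (rule self_le_power) (simp_all add: C_def)
    have bd': "bounded_mons (s + n) M" using bd by (rule bounded_mons_mono) simp
    have "length xs + ?y \<le> hardy (?F ^^ ?c) (mons_ord M) ?y"
    proof (rule h.length_add_le_hardy[OF g_mono h cov bd' _ _ _ xs])
      show "(s + n + 2) ^ 8 \<le> ?y" by (intro power_mono) (simp_all add: C_def)
      show "x0 + 4 \<le> ?y" using y by (simp add: C_def)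
    qed simp_all
    also have "\<dots> \<le> hardy (?F ^^ ?c) (omega_pow_times \<beta> N) ?y"
    proof (rule h.hardy_small)
      have "a \<le> \<beta>" if "mons_ord M = OmegaPlus a b" for a b
      proof -
        have "a \<in> exps (mons_ord M)" using that by simp
        then show ?thesis using \<beta> by (auto simp: exps_mons_ord)
      qed
      then show "mons_ord M \<le> omega_pow_times \<beta> N"
        unfolding N_def by (intro less_imp_le[OF less_omega_pow_times]) auto
      show "size (mons_ord M) < ?y" using y by (simp add: C_def N_def)
    qed simp
    also have "\<dots> \<le> ((fast_rel ?F \<beta> ^^ ?c) ^^ N) ?y"
      unfolding hardy_omega_pow_times
      by (intro funpow_mono_fun mono_pow F.mono_hardy F.fast_rel_funpow h.hardy_ge) auto
    also have "\<dots> = (fast_rel ?F \<beta> ^^ (?c * N)) ?y" by (simp only: funpow_mult)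
    finally show "length xs \<le> (fast_rel ?F \<beta> ^^ (?c * N)) ?y" by simp
  qed
  then show ?thesis by (intro exI[of _ C] exI[of _ "?c * N"]) (auto simp: C_def)
qed


section \<open>The classes of the fast-growing hierarchy\<close>

lemma funpow_double_ge:
  fixes F :: "nat \<Rightarrow> nat"
  assumes "\<And>x. 2 \<le> x \<Longrightarrow> 2 * x \<le> F x" "\<And>x. x \<le> F x" "2 \<le> v"
  shows "(i + 1) * v \<le> (F ^^ i) v"
proof (induction i)
  case (Suc i)
  have "2 \<le> (F ^^ i) v" using funpow_increasing[of F v i] assms(2,3) by simp
  have "(Suc i + 1) * v \<le> 2 * ((i + 1) * v)" by simp
  also have "\<dots> \<le> 2 * (F ^^ i) v" using Suc by simp
  also have "\<dots> \<le> F ((F ^^ i) v)" using assms(1) \<open>2 \<le> (F ^^ i) v\<close> by blast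
  finally show ?case by simp
qed simp

text \<open>A limited recursion inherits the bound of its majorant \<open>b\<close>. The shift in
  \<open>F (x + 2)\<close> lets \<open>F\<close> be a higher level than \<open>\<gamma>\<close>,
  since levels need not be ordered at small arguments.\<close>

lemma fast_class_bound:
  fixes F :: "nat \<Rightarrow> nat"
  assumes mono: "mono F" and ge: "\<And>x. x \<le> F x" and double: "\<And>x. 2 \<le> x \<Longrightarrow> 2 * x \<le> F x"
    and F: "\<And>x. fast_growing \<gamma> x \<le> F (x + 2)"
    and "fast_class \<gamma> k f"
  shows "\<exists>c. \<forall>xs. length xs = k \<longrightarrow> f xs \<le> (F ^^ c) (sum_list xs + c)"
  using assms(5)
proof induction
  case (const k c)
  have "c \<le> (F ^^ c) (sum_list xs + c)" for xs
    using funpow_increasing[of F "sum_list xs + c" c] ge by (meson add_leD2)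
  then show ?case by blast
next
  case add
  have "xs ! 0 + xs ! 1 \<le> (F ^^ 0) (sum_list xs + 0)" if "length xs = 2" for xs
    using that by (auto simp: length_Suc_conv numeral_2_eq_2)
  then show ?case by blast
next
  case (proj i k)
  then have "xs ! i \<le> (F ^^ 0) (sum_list xs + 0)" if "length xs = k" for xs
    using that by (simp add: member_le_sum_list)
  then show ?case by blast
next
  case fast
  have "fast_growing \<gamma> (xs ! 0) \<le> (F ^^ 2) (sum_list xs + 2)" if "length xs = 1" for xs
  proof -
    have "fast_growing \<gamma> (xs ! 0) \<le> F (sum_list xs + 2)"
      using F that by (auto simp: length_Suc_conv)
    also have "\<dots> \<le> F (F (sum_list xs + 2))" by (rule ge)
    finally show ?thesis by (simp add: numeral_2_eq_2)
  qed
  then show ?case by blast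
next
  case (subst hs f k)
  obtain cf where cf: "\<And>xs. length xs = length hs \<Longrightarrow> f xs \<le> (F ^^ cf) (sum_list xs + cf)"
    using subst.IH(1) by blast
  have "\<exists>c. \<forall>h\<in>set hs'. \<forall>xs. length xs = k \<longrightarrow> h xs \<le> (F ^^ c) (sum_list xs + c)"
    if "set hs' \<subseteq> set hs" for hs'
    using that
  proof (induction hs')
    case (Cons h hs')
    then obtain c where c: "\<And>h xs. h \<in> set hs' \<Longrightarrow> length xs = k \<Longrightarrow> h xs \<le> (F ^^ c) (sum_list xs + c)"
      by auto
    obtain d where d: "\<And>xs. length xs = k \<Longrightarrow> h xs \<le> (F ^^ d) (sum_list xs + d)"
      using subst.IH(2) Cons.prems by auto
    have "h' xs \<le> (F ^^ max c d) (sum_list xs + max c d)"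
      if "h' \<in> set (h # hs')" "length xs = k" for h' xs
    proof -
      have "i \<le> max c d \<Longrightarrow> (F ^^ i) (sum_list xs + i) \<le> (F ^^ max c d) (sum_list xs + max c d)" for i
        using mono ge by (intro funpow_increasing2) auto
      then show ?thesis using c d that by (metis le_trans max.cobounded1 max.cobounded2 set_ConsD)
    qed
    then show ?case by blast
  qed simp
  then obtain c where c: "\<And>h xs. h \<in> set hs \<Longrightarrow> length xs = k \<Longrightarrow> h xs \<le> (F ^^ c) (sum_list xs + c)"
    by blast
  \<comment> \<open>The inner values and the constant \<open>cf\<close> sum to at most
    \<open>l + 1\<close> copies of \<open>?V\<close>, which \<open>l\<close> iterates dominate by
    doubling; the offset \<open>c + 2\<close> makes \<open>?V\<close> at least 2.\<close>
  define l where "l = length hs + cf"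
  have "f (map (\<lambda>h. h xs) hs) \<le> (F ^^ (cf + l + c + 2)) (sum_list xs + (cf + l + c + 2))"
    if xs: "length xs = k" for xs
  proof -
    let ?V = "(F ^^ c) (sum_list xs + (c + 2))"
    have V2: "2 \<le> ?V" using funpow_increasing[of F "sum_list xs + (c + 2)" c] ge by simp
    have "h xs \<le> ?V" if "h \<in> set hs" for h
    proof -
      have "h xs \<le> (F ^^ c) (sum_list xs + c)" by (rule c[OF that xs])
      also have "\<dots> \<le> ?V" using mono ge by (intro funpow_increasing2) auto
      finally show ?thesis .
    qed
    then have "sum_list (map (\<lambda>h. h xs) hs) \<le> (\<Sum>h\<leftarrow>hs. ?V)" by (intro sum_list_mono) auto
    then have "sum_list (map (\<lambda>h. h xs) hs) + cf \<le> length hs * ?V + cf" by (simp add: sum_list_triv)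
    also have "cf \<le> cf * ?V + ?V" using V2 by (simp add: trans_le_add1)
    also have "length hs * ?V + (cf * ?V + ?V) = (l + 1) * ?V" by (simp add: l_def algebra_simps)
    also have "\<dots> \<le> (F ^^ l) ?V" using double ge V2 by (rule funpow_double_ge)
    finally have le: "sum_list (map (\<lambda>h. h xs) hs) + cf \<le> (F ^^ l) ?V" by simp
    have "f (map (\<lambda>h. h xs) hs) \<le> (F ^^ cf) (sum_list (map (\<lambda>h. h xs) hs) + cf)" by (rule cf) simp
    also have "\<dots> \<le> (F ^^ cf) ((F ^^ l) ?V)" using mono ge le by (intro funpow_increasing2) auto
    also have "\<dots> = (F ^^ (cf + l + c)) (sum_list xs + (c + 2))" by (simp add: funpow_add)
    also have "\<dots> \<le> (F ^^ (cf + l + c + 2)) (sum_list xs + (cf + l + c + 2))"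
      using mono ge by (intro funpow_increasing2) auto
    finally show ?thesis .
  qed
  then show ?case by blast
next
  case (limited_rec k h0 h b f)
  then show ?case by (meson le_trans)
qed

lemma fast_class1_bound:
  assumes "fin_ord 2 \<le> \<delta>" "\<And>x. fast_growing \<gamma> x \<le> fast_growing \<delta> (x + 2)"
    and "f \<in> fast_class1 \<gamma>"
  shows "\<exists>c x0. \<forall>x\<ge>x0. f x \<le> (fast_growing \<delta> ^^ c) x"
proof -
  let ?F = "fast_growing \<delta>"
  have dbl: "2 * x \<le> ?F x" if "2 \<le> x" for x
  proof -
    have "is_succ (fin_ord 1)" by simp
    then have "2 * x \<le> fast_growing (fin_ord 1) x"
      unfolding fast_growing_eq_fast_rel by (rule Suc.fast_rel_succ_double)
    also have "fin_ord 1 \<le> \<delta>" using assms(1) by (rule order_trans[rotated]) (simp add: numeral_2_eq_2)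
    then have "fast_growing (fin_ord 1) x \<le> ?F x"
      using that by (intro fast_growing_small) auto
    finally show ?thesis .
  qed
  obtain f' where f': "f = (\<lambda>x. f' [x])" "fast_class \<gamma> 1 f'"
    using assms(3) by (auto simp: fast_class1_def)
  obtain c where c: "\<And>xs. length xs = 1 \<Longrightarrow> f' xs \<le> (?F ^^ c) (sum_list xs + c)"
    using fast_class_bound[OF increasing.mono_h[OF increasing_fast_growing] fast_growing_ge dbl assms(2) f'(2)]
    by blast
  \<comment> \<open>Beyond \<open>c + 2\<close> the offset disappears into one more iterate:
    \<open>x + c \<le> 2 * x \<le> ?F x\<close>.\<close>
  have "f x \<le> (?F ^^ (c + 1)) x" if "c + 2 \<le> x" for x
  proof -
    have "f x \<le> (?F ^^ c) (x + c)" using c[of "[x]"] by (simp add: f'(1))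
    also have "\<dots> \<le> (?F ^^ c) (?F x)"
      using dbl[of x] that fast_growing_ge
      by (intro funpow_increasing2 increasing.mono_h[OF increasing_fast_growing]) auto
    finally show ?thesis by (simp add: funpow_swap1)
  qed
  then show ?thesis by blast
qed

lemma fast_growing_funpow_in_fast_class1: "(\<lambda>n. (fast_growing \<alpha> ^^ j) (n + C)) \<in> fast_class1 \<alpha>"
proof -
  have "fast_class \<alpha> 1 (\<lambda>xs. (fast_growing \<alpha> ^^ j) (xs ! 0 + C))"
  proof (induction j)
    case 0
    have "fast_class \<alpha> 1 (\<lambda>xs. (\<lambda>xs. xs ! 0 + xs ! 1) (map (\<lambda>h. h xs) [\<lambda>xs. xs ! 0, \<lambda>_. C]))"
      by (intro fast_class.subst)
        (use fast_class.add in \<open>auto simp: numeral_2_eq_2 intro: fast_class.const fast_class.proj\<close>)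
    then show ?case by simp
  next
    case (Suc j)
    then have "fast_class \<alpha> 1 (\<lambda>xs. (\<lambda>xs. fast_growing \<alpha> (xs ! 0))
        (map (\<lambda>h. h xs) [\<lambda>xs. (fast_growing \<alpha> ^^ j) (xs ! 0 + C)]))"
      by (intro fast_class.subst) (auto intro: fast_class.fast[unfolded One_nat_def])
    then show ?case by simp
  qed
  then show ?thesis unfolding fast_class1_def by force
qed


section \<open>Exponential nwqos as sums of monomials\<close>

text \<open>Products are distributed over sums. The empty monomial is the one-point order, so
  \<open>Gamma p\<close> becomes \<open>p\<close> points.\<close>

primrec mons :: "exp_nwqo \<Rightarrow> elem set list list" where
  "mons (Gamma p) = replicate p []"
| "mons (GammaStar p) = [[Letter ` {1..p}]]"
| "mons (Sum A B) = mons A @ mons B"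
| "mons (Prod A B) = concat (map (\<lambda>m. map (\<lambda>m'. m @ m') (mons B)) (mons A))"

lemma finite_mons: "m \<in> set (mons A) \<Longrightarrow> \<Delta> \<in> set m \<Longrightarrow> finite \<Delta>"
  by (induction A arbitrary: m) (auto split: if_splits)

lemma represents_Pair:
  assumes "represents (le A) (qnorm A) B m" "represents (le A') (qnorm A') B' m'"
  shows "represents (le (prod_nwqo A A')) (qnorm (prod_nwqo A A')) {Pair x y |x y. x \<in> B \<and> y \<in> B'} (m @ m')"
proof -
  obtain \<phi> where \<phi>: "\<And>x. x \<in> B \<Longrightarrow> list_all2 (\<lambda>w \<Delta>. set w \<subseteq> \<Delta> \<and> length w \<le> qnorm A x) (\<phi> x) m"
    "\<And>x y. x \<in> B \<Longrightarrow> y \<in> B \<Longrightarrow> list_all2 subseq (\<phi> x) (\<phi> y) \<Longrightarrow> le A x y"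
    using assms(1) unfolding represents_def by blast
  obtain \<phi>' where \<phi>': "\<And>x. x \<in> B' \<Longrightarrow> list_all2 (\<lambda>w \<Delta>. set w \<subseteq> \<Delta> \<and> length w \<le> qnorm A' x) (\<phi>' x) m'"
    "\<And>x y. x \<in> B' \<Longrightarrow> y \<in> B' \<Longrightarrow> list_all2 subseq (\<phi>' x) (\<phi>' y) \<Longrightarrow> le A' x y"
    using assms(2) unfolding represents_def by blast
  let ?\<psi> = "\<lambda>u. case u of Pair x y \<Rightarrow> \<phi> x @ \<phi>' y | _ \<Rightarrow> []"
  have "list_all2 (\<lambda>w \<Delta>. set w \<subseteq> \<Delta> \<and> length w \<le> max (qnorm A x) (qnorm A' y)) (\<phi> x @ \<phi>' y) (m @ m')"
    if "x \<in> B" "y \<in> B'" for x y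
    using list_all2_mono[OF \<phi>(1)[OF that(1)]] list_all2_mono[OF \<phi>'(1)[OF that(2)]]
    by (intro list_all2_appendI) (simp_all add: le_max_iff_disj)
  moreover have "le A x1 x2 \<and> le A' y1 y2"
    if "x1 \<in> B" "x2 \<in> B" "y1 \<in> B'" "y2 \<in> B'" "list_all2 subseq (\<phi> x1 @ \<phi>' y1) (\<phi> x2 @ \<phi>' y2)" for x1 x2 y1 y2
  proof -
    have "length (\<phi> x1) = length (\<phi> x2)"
      using list_all2_lengthD[OF \<phi>(1)] that by metis
    then show ?thesis using that \<phi>(2) \<phi>'(2) by (simp add: list_all2_append)
  qed
  ultimately show ?thesis
    unfolding represents_def by (intro exI[of _ ?\<psi>]) (auto simp: prod_nwqo_def)
qed

lemma covers_Pair1: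
  assumes "represents (le A) (qnorm A) B m" "covers (le A') (qnorm A') S M"
  shows "covers (le (prod_nwqo A A')) (qnorm (prod_nwqo A A')) {Pair x y |x y. x \<in> B \<and> y \<in> S}
    (map (\<lambda>m'. m @ m') M)"
  using assms(2)
proof (induction M arbitrary: S)
  case (Cons m' M)
  then obtain B' where B': "represents (le A') (qnorm A') B' m'" "covers (le A') (qnorm A') (S - B') M"
    by (auto simp: covers_Cons)
  have "covers (le (prod_nwqo A A')) (qnorm (prod_nwqo A A'))
      ({Pair x y |x y. x \<in> B \<and> y \<in> S} - {Pair x y |x y. x \<in> B \<and> y \<in> B'}) (map (\<lambda>m'. m @ m') M)"
    by (rule covers_subset[OF Cons.IH[OF B'(2)]]) auto
  then show ?case using represents_Pair[OF assms(1) B'(1)] by (auto simp: covers_Cons)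
qed simp

lemma covers_Pair:
  assumes "covers (le A) (qnorm A) S M" "covers (le A') (qnorm A') S' M'"
  shows "covers (le (prod_nwqo A A')) (qnorm (prod_nwqo A A')) {Pair x y |x y. x \<in> S \<and> y \<in> S'}
    (concat (map (\<lambda>m. map (\<lambda>m'. m @ m') M') M))"
  using assms(1)
proof (induction M arbitrary: S)
  case (Cons m M)
  then obtain B where B: "represents (le A) (qnorm A) B m" "covers (le A) (qnorm A) (S - B) M"
    by (auto simp: covers_Cons)
  have "covers (le (prod_nwqo A A')) (qnorm (prod_nwqo A A'))
      ({Pair x y |x y. x \<in> B \<and> y \<in> S'} \<union> {Pair x y |x y. x \<in> S - B \<and> y \<in> S'})
      (map (\<lambda>m'. m @ m') M' @ concat (map (\<lambda>m. map (\<lambda>m'. m @ m') M') M))"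
    by (rule covers_append[OF covers_Pair1[OF B(1) assms(2)] Cons.IH[OF B(2)]])
  then have "covers (le (prod_nwqo A A')) (qnorm (prod_nwqo A A')) {Pair x y |x y. x \<in> S \<and> y \<in> S'}
      (map (\<lambda>m'. m @ m') M' @ concat (map (\<lambda>m. map (\<lambda>m'. m @ m') M') M))"
    by (rule covers_subset) auto
  then show ?case by simp
qed simp

lemma covers_mons: "covers (le (nwqo_of A)) (qnorm (nwqo_of A)) (carrier (nwqo_of A)) (mons A)"
proof (induction A)
  case (Gamma p)
  have "list_all2 (represents (le (gamma_nwqo p)) (qnorm (gamma_nwqo p)))
      (map (\<lambda>i. {Letter i}) [1..<Suc p]) (map (\<lambda>_. []) [1..<Suc p])"
    unfolding list_all2_map1 list_all2_map2 list_all2_same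
    by (auto simp: represents_def gamma_nwqo_def)
  moreover have "map (\<lambda>_. []) [1..<Suc p] = mons (Gamma p)"
    by (simp add: map_replicate_const del: upt_Suc)
  moreover have "carrier (gamma_nwqo p) \<subseteq> \<Union>(set (map (\<lambda>i. {Letter i}) [1..<Suc p]))"
    by (auto simp: gamma_nwqo_def)
  ultimately show ?case unfolding covers_def by (metis nwqo_of.simps(1))
next
  case (GammaStar p)
  let ?A = "star_nwqo (gamma_nwqo p)" and ?\<phi> = "\<lambda>u. case u of Word xs \<Rightarrow> [xs] | _ \<Rightarrow> []"
  have "represents (le ?A) (qnorm ?A) (carrier ?A) [Letter ` {1..p}]"
    unfolding represents_def
    by (intro exI[of _ ?\<phi>]) (auto simp: star_nwqo_def gamma_nwqo_def)
  then show ?case by (auto simp: covers_Cons)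
next
  case (Sum A B)
  let ?AB = "sum_nwqo (nwqo_of A) (nwqo_of B)" and ?u = "\<lambda>u. case u of Tagged i x \<Rightarrow> x | _ \<Rightarrow> u"
  have "covers (le ?AB) (qnorm ?AB) (Tagged 1 ` carrier (nwqo_of A)) (mons A)"
    by (rule covers_vimage[OF Sum(1), of _ ?u]) (auto simp: sum_nwqo_def)
  moreover have "covers (le ?AB) (qnorm ?AB) (Tagged 2 ` carrier (nwqo_of B)) (mons B)"
    by (rule covers_vimage[OF Sum(2), of _ ?u]) (auto simp: sum_nwqo_def)
  ultimately have "covers (le ?AB) (qnorm ?AB)
      (Tagged 1 ` carrier (nwqo_of A) \<union> Tagged 2 ` carrier (nwqo_of B)) (mons A @ mons B)"
    by (rule covers_append)
  then show ?case by (simp add: sum_nwqo_def)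
next
  case (Prod A B)
  from covers_Pair[OF this] show ?case by (simp add: prod_nwqo_def)
qed

section \<open>Exponents of monomials and of the order type\<close>

lemma exps_omega_pow_nat_prod [simp]: "exps (omega_pow_nat_prod a t) = (\<lambda>c. a \<oplus> c) ` exps t"
  by (induction t) auto

lemma exps_nat_prod [simp]: "exps (s \<otimes> t) = {a \<oplus> c |a c. a \<in> exps s \<and> c \<in> exps t}"
  by (induction s) auto

lemma is_cnf_omega_pow_nat_prod: "is_cnf a \<Longrightarrow> is_cnf t \<Longrightarrow> is_cnf (omega_pow_nat_prod a t)"
  by (induction t) (auto intro!: is_cnf_nat_sum)

lemma is_cnf_nat_prod: "is_cnf s \<Longrightarrow> is_cnf t \<Longrightarrow> is_cnf (s \<otimes> t)"
  by (induction s) (auto intro!: is_cnf_nat_sum is_cnf_omega_pow_nat_prod)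

lemma is_cnf_max_order_type: "is_cnf (max_order_type A)"
  by (induction A) (auto intro: is_cnf_nat_sum is_cnf_nat_prod split: nat.split)

text \<open>Membership is enough because the level depends on the exponents alone; multiplicities
  affect only the number of iterates.\<close>

lemma mon_exp_mons: "m \<in> set (mons A) \<Longrightarrow> mon_exp m \<in> exps (max_order_type A)"
proof (induction A arbitrary: m)
  case (Gamma p)
  then show ?case by (cases p) (auto simp: mon_exp_def split: if_splits)
next
  case (GammaStar p)
  have "card (Letter ` {1..p}) = p" by (simp add: card_image inj_on_def)
  with GammaStar show ?case
    by (cases p) (auto simp: mon_exp_def alph_exps_def omega_pow_def)
next
  case (Prod A B)
  then show ?case by (auto simp: mon_exp_append) blast
qed auto

theorem mainTheorem2:
  fixes g :: "nat \<Rightarrow> nat" and A :: exp_nwqo and \<beta> \<gamma> :: cnf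
  assumes "is_cnf \<beta>" and "is_cnf \<gamma>"
    and "smooth g"
    and "\<exists>f \<in> fast_class1 \<gamma>. \<exists>x0. \<forall>x \<ge> x0. g x \<le> f x"
    and "max_order_type A < omega_pow (\<beta> + fin_ord 1)"
  shows "(\<gamma> < omega \<and> \<beta> \<ge> omega \<longrightarrow>
            (\<exists>f \<in> fast_class1 \<beta>. \<forall>n. length_fun (nwqo_of A) g n \<le> f n)) \<and>
         (\<gamma> \<ge> fin_ord 2 \<and> \<beta> < omega \<longrightarrow>
            (\<exists>f \<in> fast_class1 (\<gamma> + \<beta>). \<forall>n. length_fun (nwqo_of A) g n \<le> f n))"
proof -
  obtain s where s: "bounded_mons s (mons A)" using bounded_mons_exists finite_mons by metis
  \<comment> \<open>The leading exponent of the order type is below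
    \<open>\<beta> + fin_ord 1\<close> and, by normal form, is the largest one.\<close>
  have exps_le: "mon_exp m \<le> \<beta>" if "m \<in> set (mons A)" for m
  proof -
    have "mon_exp m \<in> exps (max_order_type A)" using that by (rule mon_exp_mons)
    moreover from this obtain a b where ab: "max_order_type A = OmegaPlus a b"
      by (cases "max_order_type A") auto
    ultimately have "mon_exp m \<le> a"
      using is_cnf_max_order_type[of A] by (auto simp: is_cnf_OmegaPlus simp del: is_cnf.simps)
    also have "a < \<beta> + fin_ord 1" using assms(5) ab by (simp add: omega_pow_def)
    then have "a \<le> \<beta>"
      using less_succ_imp_le_pred[of a "\<beta> + fin_ord 1"] unfolding plus_fin_ord by simp
    finally show ?thesis .
  qed
  have bound: "\<exists>C k. 4 \<le> C \<and>
      (\<forall>n. length_fun (nwqo_of A) g n \<le> (fast_rel (fast_growing \<delta>) \<beta> ^^ k) ((n + C) ^ 8))"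
    if \<delta>: "fin_ord 2 \<le> \<delta>" "\<And>x. fast_growing \<gamma> x \<le> fast_growing \<delta> (x + 2)" for \<delta>
  proof -
    obtain f x1 where f: "f \<in> fast_class1 \<gamma>" "\<And>x. x1 \<le> x \<Longrightarrow> g x \<le> f x" using assms(4) by blast
    obtain c x2 where c: "\<And>x. x2 \<le> x \<Longrightarrow> f x \<le> (fast_growing \<delta> ^^ c) x"
      using fast_class1_bound[OF \<delta> f(1)] by blast
    have "g x \<le> (fast_growing \<delta> ^^ c) x" if "x1 + x2 \<le> x" for x
      using f(2)[of x] c[of x] that by simp
    then show ?thesis using length_fun_bound[OF assms(3) \<delta>(1) _ covers_mons s exps_le] by blast
  qed
  \<comment> \<open>Three further iterates absorb the eighth power, leaving a composition that lies
    in the class.\<close>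
  have final: "\<exists>f \<in> fast_class1 \<delta>. \<forall>n. length_fun (nwqo_of A) g n \<le> f n"
    if \<delta>: "fin_ord 2 \<le> \<delta>" and C: "4 \<le> C"
      and le: "\<And>n. length_fun (nwqo_of A) g n \<le> (fast_growing \<delta> ^^ k) ((n + C) ^ 8)" for \<delta> C k
  proof -
    have "length_fun (nwqo_of A) g n \<le> (fast_growing \<delta> ^^ (k + 3)) (n + C)" for n
    proof -
      have "(n + C) ^ 8 \<le> (fast_growing \<delta> ^^ 3) (n + C)" using C by (intro pow8_le_fast_growing[OF \<delta>]) simp
      then have "(fast_growing \<delta> ^^ k) ((n + C) ^ 8) \<le> (fast_growing \<delta> ^^ k) ((fast_growing \<delta> ^^ 3) (n + C))"
        using fast_growing_ge by (intro funpow_increasing2 increasing.mono_h[OF increasing_fast_growing]) auto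
      with le[of n] show ?thesis by (simp add: funpow_add)
    qed
    then show ?thesis
      by (intro bexI[of _ "\<lambda>n. (fast_growing \<delta> ^^ (k + 3)) (n + C)"] allI fast_growing_funpow_in_fast_class1)
  qed
  have finite: "\<exists>k. \<alpha> = fin_ord k" if "is_cnf \<alpha>" "\<alpha> < omega" for \<alpha>
    using that
  proof (induction \<alpha>)
    case Zero
    have "Zero = fin_ord 0" by simp
    then show ?case by blast
  next
    case (OmegaPlus a b)
    have a: "a = Zero" using OmegaPlus.prems(2) by (cases a) (auto simp: omega_def omega_pow_def)
    have "b < omega"
      using OmegaPlus.prems(1) a by (cases b) (auto simp: omega_def omega_pow_def)
    then obtain k where "b = fin_ord k" using OmegaPlus by auto
    then have "OmegaPlus a b = fin_ord (Suc k)" using a by simp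
    then show ?case by blast
  qed
  show ?thesis
  proof (intro conjI impI)
    assume *: "\<gamma> < omega \<and> \<beta> \<ge> omega"
    obtain j where j: "\<gamma> = fin_ord j" using finite assms(2) * by blast
    \<comment> \<open>Raising the level by 2 makes squaring available even for \<gamma> = 0 or 1; an
      infinite \<beta> absorbs any finite level.\<close>
    let ?F = "fast_growing (fin_ord (j + 2))"
    have "fin_ord 2 \<le> fin_ord (j + 2)" by (simp add: numeral_2_eq_2)
    moreover have "fast_growing \<gamma> x \<le> ?F (x + 2)" for x
    proof -
      \<comment> \<open>At 0 the order of levels can fail: level 0 gives 1 and level 1 gives 0. The
        shift by 2 stays clear of this.\<close>
      have *: "fast_growing (fin_ord i) v \<le> fast_growing (fin_ord (Suc i)) v" if "1 \<le> v" for i v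
      proof -
        have "(fast_growing (fin_ord i) ^^ 1) v \<le> (fast_growing (fin_ord i) ^^ v) v"
          using fast_growing_ge that by (intro funpow_increasing_le) auto
        then show ?thesis
          using is_succ_fin_ord[of i] cnf_pred_fin_ord[of i] by (simp add: fast_growing_succ del: fin_ord_simps)
      qed
      have "fast_growing \<gamma> x \<le> fast_growing (fin_ord j) (x + 2)" unfolding j by (intro fast_growing_mono) simp
      also have "\<dots> \<le> fast_growing (fin_ord (Suc j)) (x + 2)" by (rule *) simp
      also have "\<dots> \<le> fast_growing (fin_ord (Suc (Suc j))) (x + 2)" by (rule *) simp
      finally show ?thesis by simp
    qed
    ultimately obtain C k where C: "4 \<le> C"
      and len: "\<And>n. length_fun (nwqo_of A) g n \<le> (fast_rel ?F \<beta> ^^ k) ((n + C) ^ 8)"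
      using bound by blast
    interpret F: increasing ?F by (rule increasing_fast_growing)
    have absorb: "3 \<le> (fast_rel ?F \<beta> ^^ i) x \<and>
        (fast_rel ?F \<beta> ^^ i) x + (j + 2) \<le> (fast_growing \<beta> ^^ i) (x + (j + 2))" if "3 \<le> x" for i x
    proof (induction i)
      case (Suc i)
      let ?v = "(fast_rel ?F \<beta> ^^ i) x"
      have "fast_rel ?F \<beta> ?v + (j + 2) \<le> fast_growing \<beta> (?v + (j + 2))"
        using fast_rel_fin_absorb * Suc by blast
      also have "\<dots> \<le> fast_growing \<beta> ((fast_growing \<beta> ^^ i) (x + (j + 2)))"
        using Suc by (intro fast_growing_mono) blast
      finally show ?case using Suc F.hardy_ge[of ?v "omega_pow \<beta>"] by simp
    qed (use that in simp)
    have "length_fun (nwqo_of A) g n \<le> (fast_growing \<beta> ^^ k) ((n + (C + (j + 2))) ^ 8)" for n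
    proof -
      have "n + C \<le> (n + C) ^ 8" using C by (intro self_le_power) auto
      then have "3 \<le> (n + C) ^ 8" using C by linarith
      then have "(fast_rel ?F \<beta> ^^ k) ((n + C) ^ 8) \<le> (fast_growing \<beta> ^^ k) ((n + C) ^ 8 + (j + 2))"
        using absorb[of "(n + C) ^ 8" k] by linarith
      \<comment> \<open>The shift moves into the base of the eighth power, so \<open>final\<close>
        applies with the constant \<open>C + (j + 2)\<close>.\<close>
      also have "(n + C) ^ 8 + (j + 2) \<le> (n + (C + (j + 2))) ^ 8"
      proof -
        have "a ^ 8 + b \<le> (a + b) ^ 8" if "1 \<le> a" for a b :: nat
        proof (induction b)
          case (Suc b)
          have "(a + b) ^ 8 < (a + Suc b) ^ 8" by (intro power_strict_mono) auto
          with Suc show ?case by simp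
        qed simp
        from this[of "n + C" "j + 2"] C show ?thesis by (simp add: add.assoc)
      qed
      then have "(fast_growing \<beta> ^^ k) ((n + C) ^ 8 + (j + 2)) \<le> (fast_growing \<beta> ^^ k) ((n + (C + (j + 2))) ^ 8)"
        using fast_growing_ge by (intro funpow_increasing2 increasing.mono_h[OF increasing_fast_growing]) auto
      finally show ?thesis using len[of n] by simp
    qed
    moreover have "fin_ord 2 \<le> \<beta>"
    proof -
      have "fin_ord 2 \<le> omega" by (simp add: omega_def omega_pow_def numeral_2_eq_2)
      then show ?thesis using * by (auto intro: order_trans)
    qed
    ultimately show "\<exists>f \<in> fast_class1 \<beta>. \<forall>n. length_fun (nwqo_of A) g n \<le> f n"
      using final[of \<beta> "C + (j + 2)" k] C by simp
  next
    assume *: "\<gamma> \<ge> fin_ord 2 \<and> \<beta> < omega"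
    obtain j where j: "\<beta> = fin_ord j" using finite assms(1) * by blast
    have "fast_growing \<gamma> x \<le> fast_growing \<gamma> (x + 2)" for x by (rule fast_growing_mono) simp
    then obtain C k where C: "4 \<le> C"
      and "\<And>n. length_fun (nwqo_of A) g n \<le> (fast_rel (fast_growing \<gamma>) \<beta> ^^ k) ((n + C) ^ 8)"
      using bound * by blast
    then have "\<And>n. length_fun (nwqo_of A) g n \<le> (fast_growing (\<gamma> + \<beta>) ^^ k) ((n + C) ^ 8)"
      by (simp add: j fast_rel_fast_growing_fin_ord plus_fin_ord)
    moreover have "s \<le> cnf_append s t" for s t :: cnf
      by (induction s) auto
    then have "fin_ord 2 \<le> \<gamma> + \<beta>" using * unfolding j plus_fin_ord by (meson order_trans)
    ultimately show "\<exists>f \<in> fast_class1 (\<gamma> + \<beta>). \<forall>n. length_fun (nwqo_of A) g n \<le> f n"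
      using final C by blast
  qed
qed

end
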